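(* For every integer $n\ge 5$, \[\operatorname{gon}(H_{4,n})=\begin{cases}\left\lfloor \frac{n}{4}\right\rfloor+\left\lfloor\frac{n+1}{4}\right\rfloor+2, & n<16,\\ 10, & n\ge 16.\end{cases}\]
   Context: For $n\ge5$, the Harary graph $H_{4,n}$ is the graph on vertices $v_1,\ldots,v_n$ in which $v_i$ is adjacent to $v_m$ if and only if $|i-m|\bmod n\in\{1,2\}$. For a connected loopless multigraph $G$: a divisor is a function $D:V(G)\to\mathbb{Z}$; it is effective if $D(v)\ge0$ for all $v$; its degree is $\sum_v D(v)$. Firing a vertex $v$ moves one chip from $v$ along each edge incident to $v$; two divisors are equivalent if related by a sequence of firings. $D$ has positive rank if for every vertex $q$, $D-q$ is equivalent to an effective divisor. The gonality $\operatorname{gon}(G)$ is the minimum degree of a positive rank divisor on $G$.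
   Formalization: Adjacency in H_{4,n} is read cyclically: v_i and v_m are adjacent iff i−m or m−i is congruent to 1 or 2 mod n (the standard Harary graph); the literal condition |i−m| mod n in {1,2} for indices 1,…,n would give the square of a path, for which the claim fails. *)

theory Defs
  imports Complex_Main
begin

text \<open>A multigraph is given by its vertex set and its edge multiplicities:
  \<open>mult G u v\<close> is the number of edges joining \<open>u\<close> and \<open>v\<close>.\<close>

record 'a multigraph =
  vertices :: "'a set"
  mult :: "'a \<Rightarrow> 'a \<Rightarrow> nat"

locale connected_loopless_multigraph =
  fixes G :: "'a multigraph"
  assumes finite_vertices: "finite (vertices G)"
    and vertices_nonempty: "vertices G \<noteq> {}"
    and mult_sym: "mult G u v = mult G v u"
    and mult_loopless: "mult G v v = 0"
    and mult_vertices: "mult G u v \<noteq> 0 \<Longrightarrow> u \<in> vertices G \<and> v \<in> vertices G"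
    and connected: "u \<in> vertices G \<Longrightarrow> v \<in> vertices G \<Longrightarrow>
      (u, v) \<in> {(x, y). mult G x y \<noteq> 0}\<^sup>*"

text \<open>Divisors are represented by functions on the whole vertex type that vanish off the
  vertex set.\<close>

definition divisors :: "'a multigraph \<Rightarrow> ('a \<Rightarrow> int) set" where
  "divisors G = {D. \<forall>v. v \<notin> vertices G \<longrightarrow> D v = 0}"

definition effective :: "'a multigraph \<Rightarrow> ('a \<Rightarrow> int) \<Rightarrow> bool" where
  "effective G D \<longleftrightarrow> (\<forall>v \<in> vertices G. 0 \<le> D v)"

definition degree :: "'a multigraph \<Rightarrow> ('a \<Rightarrow> int) \<Rightarrow> int" where
  "degree G D = (\<Sum>v \<in> vertices G. D v)"

definition fire :: "'a multigraph \<Rightarrow> 'a \<Rightarrow> ('a \<Rightarrow> int) \<Rightarrow> ('a \<Rightarrow> int)" where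
  "fire G v D = (\<lambda>w. if w = v then D v - (\<Sum>u \<in> vertices G. int (mult G v u))
                     else D w + int (mult G v w))"

text \<open>On a connected multigraph this relation is symmetric, since firing every vertex other
  than \<open>v\<close> undoes the firing of \<open>v\<close>.\<close>

definition equivalent :: "'a multigraph \<Rightarrow> ('a \<Rightarrow> int) \<Rightarrow> ('a \<Rightarrow> int) \<Rightarrow> bool" where
  "equivalent G = (\<lambda>D D'. \<exists>v \<in> vertices G. D' = fire G v D)\<^sup>*\<^sup>*"

definition positive_rank :: "'a multigraph \<Rightarrow> ('a \<Rightarrow> int) \<Rightarrow> bool" where
  "positive_rank G D \<longleftrightarrow>
    (\<forall>q \<in> vertices G. \<exists>D'. equivalent G (D(q := D q - 1)) D' \<and> effective G D')"

definition gonality :: "'a multigraph \<Rightarrow> int" where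
  "gonality G = (LEAST d. \<exists>D \<in> divisors G. positive_rank G D \<and> degree G D = d)"

text \<open>The Harary graph \<open>H\<^sub>4\<^sub>,\<^sub>n\<close>. Indices are compared cyclically, so that for example
  \<open>1\<close> and \<open>n\<close> are adjacent.\<close>

definition harary4_adj :: "nat \<Rightarrow> nat \<Rightarrow> nat \<Rightarrow> bool" where
  "harary4_adj n i j \<longleftrightarrow> i \<in> {1..n} \<and> j \<in> {1..n} \<and>
    ((int i - int j) mod int n \<in> {1, 2} \<or> (int j - int i) mod int n \<in> {1, 2})"

definition harary4 :: "nat \<Rightarrow> nat multigraph" where
  "harary4 n = \<lparr>vertices = {1..n}, mult = (\<lambda>i j. of_bool (harary4_adj n i j))\<rparr>"

lemma connected_loopless_multigraph_harary4:
  assumes "5 \<le> n"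
  shows "connected_loopless_multigraph (harary4 n)"
proof
  show "finite (vertices (harary4 n))" "vertices (harary4 n) \<noteq> {}"
    using assms by (auto simp: harary4_def)
  show "mult (harary4 n) u v = mult (harary4 n) v u" for u v
    by (auto simp: harary4_def harary4_adj_def)
  show "mult (harary4 n) v v = 0" for v
    by (auto simp: harary4_def harary4_adj_def)
  show "u \<in> vertices (harary4 n) \<and> v \<in> vertices (harary4 n)" if "mult (harary4 n) u v \<noteq> 0" for u v
    using that by (auto simp: harary4_def harary4_adj_def)
  let ?E = "{(x, y). mult (harary4 n) x y \<noteq> 0}"
  have step: "(i, Suc i) \<in> ?E" if "1 \<le> i" "Suc i \<le> n" for i
    using that assms by (auto simp: harary4_def harary4_adj_def)
  have from_1: "(1, Suc k) \<in> ?E\<^sup>*" if "Suc k \<le> n" for k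
    using that
  proof (induction k)
    case (Suc k)
    then show ?case using step[of "Suc k"] by (simp add: rtrancl_into_rtrancl)
  qed simp
  have "sym ?E"
    by (auto simp: sym_def harary4_def harary4_adj_def)
  then have sym: "sym (?E\<^sup>*)"
    by (rule sym_rtrancl)
  show "(u, v) \<in> ?E\<^sup>*" if "u \<in> vertices (harary4 n)" "v \<in> vertices (harary4 n)" for u v
  proof -
    have "(1, u) \<in> ?E\<^sup>*" "(1, v) \<in> ?E\<^sup>*"
      using from_1[of "u - 1"] from_1[of "v - 1"] that by (auto simp: harary4_def)
    then show ?thesis
      using sym by (meson rtrancl_trans symD)
  qed
qed

end

theory Submission
  imports Defs
begin

text \<open>A divisor on the Harary graph is an \<open>n\<close>-periodic function on the integers, and firing the
  script \<open>f\<close> subtracts \<open>lap f\<close>. Firing an arc of at least two vertices takes 2 and 1 chips from its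
  outermost two vertices at each end and puts them, mirrored, on the two vertices beyond that end.

  Upper bound: two stacks 1, 3, 1 facing each other travel apart around the cycle when the arcs
  between them are fired, so degree 10 always suffices. On short cycles a stack of 4 chips, with a
  few chips waiting where its two halves need them, reaches every vertex more cheaply.

  Lower bound: let \<open>d \<le> 9\<close> and choose an effective divisor of the class with least sum of squares; it
  has at most 3 chips on each vertex. A zero next to another zero, or next to a lone chip
  that is itself followed by a zero, is called slack. Without slack zeros discharging gives
  \<open>2 n \<le> 3 d\<close>. A legal firing set avoiding a slack zero has a cut of at most 9 edges and is therefore
  an arc, up to a few exceptions that the minimality of \<open>D\<close> or a count of chips rules out. Firing the
  arc moves six chips and leaves the other \<open>d - 6 \<le> 3\<close> in place. If neither the arc before
  firing nor its complement after firing contains slack, discharging on both bounds \<open>n\<close>. Otherwise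
  a slack zero yields a second legal arc, whose ends bind the free chips, so that the
  remaining arcs have no slack and are again short.\<close>

section \<open>Boundaries of vertex sets on the cycle\<close>

text \<open>The six thresholds on \<open>n\<close> come from three inequalities. A cycle without
  slack satisfies \<open>2 * n \<le> 3 * d\<close>, which settles degrees 4 and 5. An arc and its
  complement each contribute 10 to twice the length (four front vertices, plus one unit lost at
  either end of the discharged stretch), so \<open>2 * n \<le> 20 + 3 * (d - 6)\<close>, which
  settles 6 and 7. A second legal arc relaxes this to \<open>2 * n \<le> 22 + 3 * (d - 6)\<close>,
  which settles 8 and 9. The largest lengths allowed, 6, 7, 10, 11, 14 and 15, are exactly those
  where the explicit divisors of these degrees stop working. The obstacle is that a least sum of
  squares limits piles but not arcs: firing an arc only moves its fronts and need not lower the sum.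
  Hence arcs are counted before and after firing. Slack looks to the right only, and patterns come
  in mirror pairs. The lower bound is therefore proved for an abstract set of divisors, whose
  reflection is again such a set.\<close>

definition lap :: "(int \<Rightarrow> int) \<Rightarrow> int \<Rightarrow> int" where
  "lap f i = 4 * f i - f (i + 1) - f (i - 1) - f (i + 2) - f (i - 2)"

text \<open>For a vertex of \<open>X\<close>, the number of chips it loses when \<open>X\<close> is
  fired.\<close>

definition exits :: "int set \<Rightarrow> int \<Rightarrow> int" where
  "exits X i = of_bool (i + 1 \<notin> X) + of_bool (i - 1 \<notin> X) + of_bool (i + 2 \<notin> X) + of_bool (i - 2 \<notin> X)"

definition lfront :: "int \<Rightarrow> int \<Rightarrow> int" where
  "lfront p j = (if j = p then 2 else if j = p + 1 then 1 else 0)"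

definition rfront :: "int \<Rightarrow> int \<Rightarrow> int" where
  "rfront q j = (if j = q then 2 else if j = q - 1 then 1 else 0)"

text \<open>A legal firing set that avoids a slack zero \<open>i\<close> must avoid \<open>i + 1\<close> too.\<close>

definition slack :: "(int \<Rightarrow> int) \<Rightarrow> int \<Rightarrow> bool" where
  "slack D i \<longleftrightarrow> D i = 0 \<and> (D (i + 1) = 0 \<or> D (i + 1) = 1 \<and> D (i + 2) = 0)"

lemma exits_nonneg: "0 \<le> exits X i"
  by (simp add: exits_def)

text \<open>Shifting by \<open>s\<close> matches the elements whose successor stays in
  \<open>Y\<close> with those whose predecessor lies in \<open>Y\<close>; the complements in
  \<open>Y\<close> have equal size too.\<close>

lemma card_shift_out:
  fixes Y :: "int set"
  assumes "finite Y"
  shows "card {v \<in> Y. v + s \<notin> Y} = card {v \<in> Y. v - s \<notin> Y}"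
proof -
  have "card {v \<in> Y. v + s \<in> Y} = card {v \<in> Y. v - s \<in> Y}"
  proof -
    have "(\<lambda>v. v + s) ` {v \<in> Y. v + s \<in> Y} = {v \<in> Y. v - s \<in> Y}"
      by (force intro: image_eqI[of _ _ "_ - s"])
    then show ?thesis
      by (metis (no_types, lifting) add_right_cancel card_image inj_onI)
  qed
  moreover have "card Y = card {v \<in> Y. v + s \<in> Y} + card {v \<in> Y. v + s \<notin> Y}"
    by (subst card_Un_disjoint[symmetric]) (use assms in \<open>auto intro: arg_cong[where f = card]\<close>)
  moreover have "card Y = card {v \<in> Y. v - s \<in> Y} + card {v \<in> Y. v - s \<notin> Y}"
    by (subst card_Un_disjoint[symmetric]) (use assms in \<open>auto intro: arg_cong[where f = card]\<close>)
  ultimately show ?thesis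
    by linarith
qed

lemma sum_exits:
  assumes "finite Y"
  shows "(\<Sum>v\<in>Y. exits Y v) = 2 * (int (card {v \<in> Y. v + 1 \<notin> Y}) + int (card {v \<in> Y. v + 2 \<notin> Y}))"
proof -
  have [simp]: "(\<Sum>v\<in>Y. of_bool (P v)) = int (card {v \<in> Y. P v})" for P
    using assms by (simp add: Collect_conj_eq Int_commute)
  show ?thesis
    using card_shift_out[OF assms, of 1] card_shift_out[OF assms, of 2]
    by (simp add: exits_def sum.distrib)
qed

text \<open>By \<open>sum_exits\<close> a cut below 10 leaves room for at most four steps of length 1 or 2
  out of \<open>Y\<close> to the right.\<close>

lemma small_cut_cases:
  fixes Y :: "int set"
  assumes fin: "finite Y" and ne: "Y \<noteq> {}"
    and cut: "(\<Sum>v\<in>Y. exits Y v) \<le> 9" and flat: "\<And>v. v \<in> Y \<Longrightarrow> exits Y v \<le> 3"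
  obtains p q where "p < q" "Y = {p..q}"
  | p where "Y = {p, p + 2}"
  | p where "Y = {p, p + 2, p + 4}"
  | p q where "p + 3 \<le> q" "Y = {p..q} - {q - 1}"
  | p q where "p + 3 \<le> q" "Y = {p..q} - {p + 1}"
proof -
  define p where "p = Min Y"
  define q where "q = Max Y"
  have pY: "p \<in> Y" and qY: "q \<in> Y" and sub: "Y \<subseteq> {p..q}"
    using fin ne by (auto simp: p_def q_def)
  have lo: "v \<notin> Y" if "v < p" for v using sub that by auto
  have hi: "v \<notin> Y" if "v > q" for v using sub that by auto
  define A where "A = {v \<in> Y. v + 1 \<notin> Y}"
  define B where "B = {v \<in> Y. v + 2 \<notin> Y}"
  have finAB: "finite A" "finite B"
    using fin by (auto simp: A_def B_def)
  \<comment> \<open>The cut is twice \<open>card A + card B\<close>, so a cut of at most 9 is at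
    most 8.\<close>
  have AB: "card A + card B \<le> 4"
    using cut sum_exits[OF fin] unfolding A_def B_def by arith
  have count: False if "A' \<subseteq> A" "B' \<subseteq> B" "card A' + card B' \<ge> 5" for A' B'
    using AB that card_mono[OF finAB(1) that(1)] card_mono[OF finAB(2) that(2)] by linarith
  have qA: "q \<in> A" and qB: "q \<in> B"
    using qY hi by (auto simp: A_def B_def)
  \<comment> \<open>Otherwise all four edges at the least element would leave \<open>Y\<close>,
    against \<open>flat\<close>.\<close>
  have p_next: "p + 1 \<in> Y \<or> p + 2 \<in> Y"
    using flat[OF pY] lo[of "p - 1"] lo[of "p - 2"] by (auto simp: exits_def of_bool_def split: if_splits)
  have q_prev: "q - 1 \<in> Y \<or> q - 2 \<in> Y"
    using flat[OF qY] hi[of "q + 1"] hi[of "q + 2"] by (auto simp: exits_def of_bool_def split: if_splits)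
  have run: "{s..t} \<subseteq> Y" if "s \<in> Y" "\<And>v. v \<in> A \<Longrightarrow> s \<le> v \<Longrightarrow> t \<le> v" for s t
  proof
    fix v assume "v \<in> {s..t}"
    then have "s \<le> v" "v \<le> t" by auto
    then show "v \<in> Y"
    proof (induction v rule: int_ge_induct)
      case base then show ?case using that(1) by simp
    next
      case (step v)
      then show ?case using that(2)[of v] by (force simp: A_def)
    qed
  qed
  show thesis
  proof (cases "p + 1 \<in> Y")
    case p1: False
    then have p2: "p + 2 \<in> Y" using p_next by auto
    have pA: "p \<in> A" using pY p1 by (auto simp: A_def)
    have pq: "p + 2 \<le> q" using p2 sub by auto
    show thesis
    proof (cases "q = p + 2")
      case True
      then have "Y = {p, p + 2}"
        using sub pY p2 p1 by (auto simp: subset_iff) (smt (verit))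
      then show thesis using that(2) by blast
    next
      case False
      then have pq3: "p + 3 \<le> q" using pq by auto
      show thesis
      proof (cases "q - 1 \<in> Y")
        case True
        then have qB1: "q - 1 \<in> B" using hi by (auto simp: B_def)
        have "v = p \<or> v = q" if "v \<in> A" for v
        proof (rule ccontr)
          assume "\<not> ?thesis"
          then show False
            using count[of "{p, q, v}" "{q - 1, q}"] that pA qA qB qB1 pq by auto
        qed
        then have "{p + 2..q} \<subseteq> Y"
          using run[OF p2, of q] by force
        then have "Y = {p..q} - {p + 1}"
          using sub pY p1 by (auto simp: subset_iff) (smt (verit))+
        then show thesis using that(5) pq3 by blast
      next
        case q1: False
        then have q2: "q - 2 \<in> Y" using q_prev by auto
        then have q2A: "q - 2 \<in> A" using q1 by (auto simp: A_def)
        have "q \<noteq> p + 3" using q2 p1 by (auto simp: algebra_simps)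
        then have pq4: "p + 4 \<le> q" using pq3 by auto
        \<comment> \<open>\<open>p\<close>, \<open>q - 2\<close>, \<open>q\<close> in
          \<open>A\<close> and \<open>q\<close> in \<open>B\<close> use up the budget of
          four.\<close>
        have A3: "v \<in> {p, q - 2, q}" if "v \<in> A" for v
        proof (rule ccontr)
          assume "\<not> ?thesis"
          then show False
            using count[of "{p, q - 2, q, v}" "{q}"] that pA qA qB q2A pq4 by auto
        qed
        have "q = p + 4"
        proof (rule ccontr)
          assume "q \<noteq> p + 4"
          then have "p + 5 \<le> q" using pq4 by auto
          moreover have "{p + 2..q - 2} \<subseteq> Y"
            using run[OF p2, of "q - 2"] A3 by force
          ultimately have "q - 3 \<in> B" using q1 by (auto simp: B_def)
          then show False
            using count[of "{p, q - 2, q}" "{q - 3, q}"] pA qA qB q2A pq4 by auto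
        qed
        then have "Y = {p, p + 2, p + 4}"
          using sub pY p2 p1 qY q1 by (auto simp: subset_iff) (smt (verit))
        then show thesis using that(3) by blast
      qed
    qed
  next
    case p1: True
    then have pq: "p < q" using sub by auto
    show thesis
    proof (cases "q - 1 \<in> Y")
      case True
      then have qB1: "q - 1 \<in> B" using hi by (auto simp: B_def)
      have "{p..q} \<subseteq> Y"
      proof (rule ccontr)
        assume "\<not> ?thesis"
        then obtain h where h: "p \<le> h" "h \<le> q" "h \<notin> Y" by (auto simp: subset_iff)
        define H where "H = {p..q} - Y"
        have H: "finite H" "h \<in> H" using h by (auto simp: H_def)
        \<comment> \<open>The first hole \<open>k\<close> puts \<open>k - 1\<close> into
          \<open>A\<close> and \<open>k - 2\<close> into \<open>B\<close>, one more than the budget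
          allows.\<close>
        define k where "k = Min H"
        have "H \<noteq> {}" using H by blast
        then have k: "k \<in> H" "\<And>v. v \<in> H \<Longrightarrow> k \<le> v"
          using Min_in[OF H(1)] Min_le[OF H(1)] unfolding k_def by blast+
        have kp: "p + 2 \<le> k" "k < q - 1"
          using k(1) pY p1 qY True unfolding H_def by (smt (verit) DiffD1 DiffD2 atLeastAtMost_iff)+
        have "k - 1 \<in> Y" "k - 2 \<in> Y"
          using k(2)[of "k - 1"] k(2)[of "k - 2"] kp by (auto simp: H_def)
        then have "k - 1 \<in> A" "k - 2 \<in> B"
          using k(1) by (auto simp: A_def B_def H_def)
        then show False
          using count[of "{k - 1, q}" "{k - 2, q - 1, q}"] qA qB qB1 kp by auto
      qed
      then have "Y = {p..q}" using sub by auto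
      then show thesis using that(1) pq by blast
    next
      case q1: False
      then have q2: "q - 2 \<in> Y" using q_prev by auto
      then have q2A: "q - 2 \<in> A" using q1 by (auto simp: A_def)
      have pq3: "p + 3 \<le> q" using p1 q1 q2 pq sub by (auto simp: subset_iff) (smt (verit))
      show thesis
      proof (cases "q - 3 \<in> Y")
        case True
        then have qB3: "q - 3 \<in> B" using q1 by (auto simp: B_def)
        have A2: "v = q - 2 \<or> v = q" if "v \<in> A" for v
        proof (rule ccontr)
          assume "\<not> ?thesis"
          then show False
            using count[of "{q - 2, q, v}" "{q - 3, q}"] that q2A qA qB qB3 by auto
        qed
        have "{p..q - 2} \<subseteq> Y"
          using run[OF pY, of "q - 2"] A2 by force
        then have "Y = {p..q} - {q - 1}"
          using sub qY q1 by (auto simp: subset_iff) (smt (verit))+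
        then show thesis using that(4) pq3 by blast
      next
        case q3: False
        have ex: "\<exists>u\<in>A. u < w" if "w \<notin> Y" "p < w" for w
        proof (rule ccontr)
          assume no: "\<not> ?thesis"
          then have "{p..w} \<subseteq> Y"
            using run[OF pY, of w] by force
          moreover have "w \<in> {p..w}" using that by simp
          ultimately show False using that(1) by blast
        qed
        have pq4: "p + 5 \<le> q"
          using p1 q3 pq3 pY q1 by (smt (verit) )
        obtain u where u: "u \<in> A" "u < q - 3"
          using ex[OF q3] pq4 by auto
        \<comment> \<open>The budget is exhausted by \<open>u\<close>, \<open>q - 2\<close>,
          \<open>q\<close> in \<open>A\<close> and \<open>q\<close> in \<open>B\<close>. This forces
          \<open>u\<close> to be a run of length one that is not the first run, and the right end of
          an earlier run is a fifth element.\<close>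
        have AA: "v \<in> {u, q - 2, q}" if "v \<in> A" for v
        proof (rule ccontr)
          assume "\<not> ?thesis"
          then show False
            using count[of "{u, q - 2, q, v}" "{q}"] that u q2A qA qB by auto
        qed
        have BB: "v = q" if "v \<in> B" for v
        proof (rule ccontr)
          assume "\<not> ?thesis"
          then show False
            using count[of "{u, q - 2, q}" "{q, v}"] that u q2A qA qB by auto
        qed
        have "u \<notin> B" using BB u by force
        then have u2: "u + 2 \<in> Y" "u + 1 \<notin> Y" using u by (auto simp: A_def B_def)
        have u5: "u + 2 \<noteq> q - 3" using u2 q3 by metis
        have u1: "u - 1 \<notin> Y"
          using BB[of "u - 1"] u2 u by (auto simp: B_def algebra_simps)
        moreover have "p < u - 1"
        proof -
          have "u \<in> Y" using u by (simp add: A_def)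
          then have "p \<le> u" using lo[of u] by fastforce
          moreover have "u \<noteq> p" using u2 p1 by metis
          moreover have "u \<noteq> p + 1" using u1 pY by auto
          ultimately show ?thesis by linarith
        qed
        ultimately obtain w where "w \<in> A" "w < u - 1"
          using ex by blast
        then show thesis using AA[of w] u by auto
      qed
    qed
  qed
qed

section \<open>Classes of divisors on the cycle\<close>

definition periodic :: "int \<Rightarrow> (int \<Rightarrow> 'a) \<Rightarrow> bool" where
  "periodic n f \<longleftrightarrow> (\<forall>i. f (i + n) = f i)"

lemma periodic_mult:
  assumes "periodic n f"
  shows "f (i + k * n) = f i"
proof (induction k rule: int_induct[where k = 0])
  case (step1 k)
  have "f (i + (k + 1) * n) = f (i + k * n + n)"
    by (simp add: algebra_simps)
  then show ?case using assms step1 by (simp add: periodic_def)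
next
  case (step2 k)
  have "f (i + (k - 1) * n) = f (i + (k - 1) * n + n)"
    using assms by (simp add: periodic_def)
  also have "\<dots> = f (i + k * n)" by (simp add: algebra_simps)
  finally show ?case using step2 by simp
qed simp

text \<open>\<open>w + (x - w) mod n\<close> is the representative of \<open>x\<close> in the window
  \<open>{w..<w + n}\<close>. A well-chosen \<open>w\<close> keeps all chips of interest away from
  the wrap-around.\<close>

lemma periodic_mod:
  assumes "periodic n f"
  shows "f (w + (x - w) mod n) = f x"
  using periodic_mult[OF assms, of x "- ((x - w) div n)"]
  by (simp add: algebra_simps minus_div_mult_eq_mod[symmetric])

lemma periodic_minus: "periodic n f \<Longrightarrow> f (i - n) = f i"
  using periodic_mult[of n f i "-1"] by simp

lemma sum_window:
  fixes f :: "int \<Rightarrow> int"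
  assumes "periodic n f" "0 < n"
  shows "(\<Sum>j\<in>{w..<w + n}. f j) = (\<Sum>j\<in>{0..<n}. f j)"
proof -
  have step: "(\<Sum>j\<in>{w + 1..<w + 1 + n}. f j) = (\<Sum>j\<in>{w..<w + n}. f j)" for w
  proof -
    have "{w..<w + n} = insert w {w + 1..<w + n}" "{w + 1..<w + 1 + n} = insert (w + n) {w + 1..<w + n}"
      using assms(2) by auto
    then show ?thesis using assms(1) by (simp add: periodic_def)
  qed
  show ?thesis
  proof (induction w rule: int_induct[where k = 0])
    case (step1 w)
    then show ?case using step[of w] by simp
  next
    case (step2 w)
    then show ?case using step[of "w - 1"] by simp
  qed simp
qed

text \<open>The loss at the left end of an arc that lacks its second vertex: \<open>p\<close> loses
  3, and the other two neighbours \<open>p + 2\<close> and \<open>p + 3\<close> of the hole inside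
  the arc lose 1 each.\<close>

definition lhook :: "int \<Rightarrow> int \<Rightarrow> int" where
  "lhook p j = (if j = p then 3 else if j = p + 2 \<or> j = p + 3 then 1 else 0)"

definition rhook :: "int \<Rightarrow> int \<Rightarrow> int" where
  "rhook q j = (if j = q then 3 else if j = q - 2 \<or> j = q - 3 then 1 else 0)"

lemma exits_interval:
  assumes "p < q" "p \<le> j" "j \<le> q"
  shows "lfront p j + rfront q j \<le> exits {p..q} j"
proof -
  have "exits {p..q} j = of_bool (q < j + 1) + of_bool (j - 1 < p) + of_bool (q < j + 2) + of_bool (j - 2 < p)"
    using assms by (simp add: exits_def not_le)
  then show ?thesis
    using assms by (simp add: lfront_def rfront_def of_bool_def)
qed

lemma exits_right_hook:
  assumes "p + 3 \<le> q" "p \<le> j" "j \<le> q" "j \<noteq> q - 1"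
  shows "lfront p j + rhook q j \<le> exits ({p..q} - {q - 1}) j"
proof -
  have "exits ({p..q} - {q - 1}) j = of_bool (q < j + 1 \<or> j + 1 = q - 1) + of_bool (j - 1 < p \<or> j = q)
      + of_bool (q < j + 2 \<or> j + 2 = q - 1) + of_bool (j - 2 < p)"
    using assms by (auto simp: exits_def not_le)
  then show ?thesis
    using assms by (simp add: lfront_def rhook_def of_bool_def)
qed

lemma exits_left_hook:
  assumes "p + 3 \<le> q" "p \<le> j" "j \<le> q" "j \<noteq> p + 1"
  shows "lhook p j + rfront q j \<le> exits ({p..q} - {p + 1}) j"
proof -
  have "exits ({p..q} - {p + 1}) j = of_bool (q < j + 1 \<or> j = p) + of_bool (j - 1 < p \<or> j - 1 = p + 1)
      + of_bool (q < j + 2) + of_bool (j - 2 < p \<or> j - 2 = p + 1)"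
    using assms by (auto simp: exits_def not_le)
  then show ?thesis
    using assms by (simp add: rfront_def lhook_def of_bool_def)
qed

locale cyclic =
  fixes n :: int
  assumes n5: "5 \<le> n"

text \<open>\<open>C\<close> stands for the effective divisors of one class: closed under legal
  firing, and from any member every vertex \<open>x\<close> can be given a chip. The instance is
  \<open>effective_class\<close>; unlike a graph, this description is easily reflected.\<close>

locale positive_rank_class = cyclic n for n :: int +
  fixes d :: int and C :: "(int \<Rightarrow> int) set"
  assumes nonempty: "C \<noteq> {}"
    and per: "D \<in> C \<Longrightarrow> periodic n D"
    and nonneg: "D \<in> C \<Longrightarrow> 0 \<le> D i"
    and deg: "D \<in> C \<Longrightarrow> (\<Sum>j\<in>{0..<n}. D j) = d"
    and fire: "D \<in> C \<Longrightarrow> periodic n f \<Longrightarrow> (\<And>i. lap f i \<le> D i) \<Longrightarrow> (\<lambda>i. D i - lap f i) \<in> C"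
    and reach: "D \<in> C \<Longrightarrow> \<exists>f. periodic n f \<and> (\<lambda>i. D i - lap f i) \<in> C \<and> 1 \<le> D x - lap f x"
begin

lemma degree_window: "D \<in> C \<Longrightarrow> (\<Sum>j\<in>{w..<w + n}. D j) = d"
  using sum_window[OF per] deg n5 by simp

lemma sum_le_degree:
  assumes "D \<in> C" "S \<subseteq> {w..<w + n}"
  shows "(\<Sum>j\<in>S. D j) \<le> d"
proof -
  have "(\<Sum>j\<in>S. D j) \<le> (\<Sum>j\<in>{w..<w + n}. D j)"
    using assms nonneg by (intro sum_mono2) auto
  then show ?thesis using degree_window[OF assms(1)] by simp
qed

text \<open>The set where a firing script attains its maximum can be fired legally on its own.\<close>

lemma legal_set_avoiding:
  assumes D: "D \<in> C" and x: "D x = 0"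
  obtains X where "periodic n (\<lambda>i. i \<in> X)" "X \<noteq> {}" "x \<notin> X" "\<And>i. i \<in> X \<Longrightarrow> exits X i \<le> D i"
proof -
  obtain f where f: "periodic n f" "(\<lambda>i. D i - lap f i) \<in> C" "1 \<le> D x - lap f x"
    using reach[OF D] by blast
  define M where "M = Max (f ` {0..<n})"
  define X where "X = {i. f i = M}"
  have le: "f i \<le> M" for i
  proof -
    have "f i = f (0 + (i - 0) mod n)" using periodic_mod[OF f(1), of 0 i] by simp
    also have "\<dots> \<le> M" unfolding M_def using n5 by (intro Max_ge) auto
    finally show ?thesis .
  qed
  have "M \<in> f ` {0..<n}" unfolding M_def using n5 by (intro Max_in) auto
  then have "X \<noteq> {}" by (auto simp: X_def)
  moreover have "periodic n (\<lambda>i. i \<in> X)" using f(1) by (simp add: X_def periodic_def)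
  moreover have ex: "exits X i \<le> lap f i" if "i \<in> X" for i
  proof -
    have "of_bool (j \<notin> X) \<le> M - f j" for j
      using le[of j] by (auto simp: X_def)
    from this[of "i + 1"] this[of "i - 1"] this[of "i + 2"] this[of "i - 2"]
    show ?thesis using that by (simp add: exits_def lap_def X_def)
  qed
  moreover have "lap f i \<le> D i" for i using nonneg[OF f(2), of i] by simp
  moreover have "x \<notin> X" using ex[of x] exits_nonneg[of X x] f(3) x by fastforce
  ultimately show thesis using that by (meson order_trans)
qed

text \<open>The legal set misses the adjacent vertices \<open>i\<close> and \<open>i + 1\<close>,
  and no edge jumps over two vertices. So the cycle may be cut there and its exits computed on the
  line. Each exit costs a chip, the cut is at most \<open>d\<close>, and
  \<open>small_cut_cases\<close> applies. Holes that carry enough chips are filled, which leaves an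
  arc.\<close>

lemma legal_pattern:
  assumes D: "D \<in> C" and d9: "d \<le> 9" and flat: "\<And>j. D j \<le> 3" and slack: "slack D i"
  obtains (interval) p q where "i + 2 \<le> p" "p < q" "q < i + n" "\<And>j. lfront p j + rfront q j \<le> D j"
  | (pair) p where "i + 2 \<le> p" "p + 2 < i + n" "D p = 3" "D (p + 2) = 3" "D (p + 1) \<le> 1"
  | (triple) p where "i + 2 \<le> p" "p + 4 < i + n" "D p = 3" "2 \<le> D (p + 2)" "D (p + 4) = 3"
  | (right_hook) p q where "i + 2 \<le> p" "p + 3 \<le> q" "q < i + n" "D (q - 1) = 0"
      "\<And>j. lfront p j + rhook q j \<le> D j"
  | (left_hook) p q where "i + 2 \<le> p" "p + 3 \<le> q" "q < i + n" "D (p + 1) = 0"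
      "\<And>j. lhook p j + rfront q j \<le> D j"
proof -
  have D0: "D i = 0" using slack by (simp add: slack_def)
  obtain X where X: "periodic n (\<lambda>i. i \<in> X)" "X \<noteq> {}" "i \<notin> X" "\<And>j. j \<in> X \<Longrightarrow> exits X j \<le> D j"
    using legal_set_avoiding[OF D D0] by blast
  \<comment> \<open>A legal set with \<open>i + 1\<close> but without \<open>i\<close> needs a chip
    on \<open>i + 1\<close>. If it is the only one, \<open>i + 2\<close> must also be in the set,
    but that vertex is empty and adjacent to \<open>i\<close>.\<close>
  have i1: "i + 1 \<notin> X"
  proof
    assume in1: "i + 1 \<in> X"
    then have e: "exits X (i + 1) \<le> D (i + 1)" using X(4) by blast
    have "1 \<le> exits X (i + 1)" using X(3) by (simp add: exits_def)
    then have s: "D (i + 1) = 1" "D (i + 2) = 0" using slack e by (auto simp: slack_def)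
    then have in2: "i + 2 \<in> X"
      using e X(3) by (auto simp: exits_def of_bool_def algebra_simps split: if_splits)
    have "1 \<le> exits X (i + 2)" using X(3) by (simp add: exits_def)
    then show False using X(4)[OF in2] s by simp
  qed
  define Y where "Y = X \<inter> {i + 2..i + n - 1}"
  have fin: "finite Y" by (simp add: Y_def)
  have in1: "i + n \<notin> X" "i + 1 + n \<notin> X" using X(1,3) i1 by (auto simp: periodic_def)
  have YX: "j \<in> Y \<longleftrightarrow> j \<in> X" if "i \<le> j" "j \<le> i + n + 1" for j
  proof -
    have "j = i \<or> j = i + 1 \<or> j = i + n \<or> j = i + 1 + n \<or> (i + 2 \<le> j \<and> j \<le> i + n - 1)"
      using that by linarith
    then show ?thesis using in1 X(3) i1 by (auto simp: Y_def)
  qed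
  have exY: "exits Y v = exits X v" if "v \<in> Y" for v
    using that YX[of "v + 1"] YX[of "v - 1"] YX[of "v + 2"] YX[of "v - 2"]
    by (auto simp: exits_def Y_def)
  have le: "exits Y v \<le> D v" if "v \<in> Y" for v
    using exY[OF that] X(4)[of v] that by (simp add: Y_def)
  have ne: "Y \<noteq> {}"
  proof -
    obtain x where "x \<in> X" using X(2) by blast
    then have "i + (x - i) mod n \<in> X" using periodic_mod[OF X(1), of i x] by simp
    moreover have "0 \<le> (x - i) mod n" "(x - i) mod n < n" using n5 by auto
    ultimately show ?thesis using YX[of "i + (x - i) mod n"] by force
  qed
  have "(\<Sum>v\<in>Y. exits Y v) \<le> (\<Sum>v\<in>Y. D v)" by (rule sum_mono) (rule le)
  also have "\<dots> \<le> d" by (rule sum_le_degree[OF D, of _ i]) (auto simp: Y_def)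
  finally have cut: "(\<Sum>v\<in>Y. exits Y v) \<le> 9" using d9 by simp
  have bnd: "i + 2 \<le> v" "v < i + n" if "v \<in> Y" for v using that by (auto simp: Y_def)
  note nn = nonneg[OF D]
  have flat': "exits Y v \<le> 3" if "v \<in> Y" for v using le[OF that] flat[of v] by linarith
  show thesis
  proof (rule small_cut_cases[OF fin ne cut flat'])
    fix p q assume pq: "p < q" "Y = {p..q}"
    have "lfront p j + rfront q j \<le> D j" for j
    proof (cases "j \<in> Y")
      case True
      then show ?thesis using le[OF True] pq exits_interval[of p q j] by auto
    next
      case False
      then show ?thesis using pq nn[of j] by (auto simp: lfront_def rfront_def)
    qed
    then show thesis using interval[of p q] bnd[of p] bnd[of q] pq by auto
  next
    fix p assume Y: "Y = {p, p + 2}"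
    have 1: "D p = 3" "D (p + 2) = 3"
      using le[of p] le[of "p + 2"] flat[of p] flat[of "p + 2"] Y by (auto simp: exits_def)
    show thesis
    proof (cases "D (p + 1) \<le> 1")
      case True
      then show thesis using pair[of p] 1 bnd[of p] bnd[of "p + 2"] Y by auto
    next
      case False
      \<comment> \<open>Two chips in the middle make the whole arc of three vertices legal.\<close>
      then have "lfront p j + rfront (p + 2) j \<le> D j" for j
        using 1 nn[of j] by (auto simp: lfront_def rfront_def algebra_simps)
      then show thesis using interval[of p "p + 2"] bnd[of p] bnd[of "p + 2"] Y by auto
    qed
  next
    fix p assume Y: "Y = {p, p + 2, p + 4}"
    have "D p = 3" "2 \<le> D (p + 2)" "D (p + 4) = 3"
      using le[of p] le[of "p + 2"] le[of "p + 4"] flat[of p] flat[of "p + 4"] Y by (auto simp: exits_def)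
    then show thesis using triple[of p] bnd[of p] bnd[of "p + 4"] Y by auto
  next
    fix p q assume pq: "p + 3 \<le> q" "Y = {p..q} - {q - 1}"
    have 1: "lfront p j + rhook q j \<le> D j" for j
    proof (cases "j \<in> Y")
      case True
      then show ?thesis using le[OF True] pq exits_right_hook[of p q j] by auto
    next
      case False
      then show ?thesis using pq nn[of j] by (auto simp: lfront_def rhook_def)
    qed
    show thesis
    proof (cases "D (q - 1) = 0")
      case True
      then show thesis using right_hook[of p q] 1 bnd[of p] bnd[of q] pq by auto
    next
      case False
      have "lfront p j + rfront q j \<le> D j" for j
        using 1[of j] nn[of j] nn[of "q - 1"] False pq
        by (auto simp: lfront_def rhook_def rfront_def split: if_splits)
      then show thesis using interval[of p q] bnd[of p] bnd[of q] pq by auto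
    qed
  next
    fix p q assume pq: "p + 3 \<le> q" "Y = {p..q} - {p + 1}"
    have 1: "lhook p j + rfront q j \<le> D j" for j
    proof (cases "j \<in> Y")
      case True
      then show ?thesis using le[OF True] pq exits_left_hook[of p q j] by auto
    next
      case False
      then show ?thesis using pq nn[of j] by (auto simp: rfront_def lhook_def)
    qed
    show thesis
    proof (cases "D (p + 1) = 0")
      case True
      then show thesis using left_hook[of p q] 1 bnd[of p] bnd[of q] pq by auto
    next
      case False
      have "lfront p j + rfront q j \<le> D j" for j
        using 1[of j] nn[of j] nn[of "p + 1"] False pq
        by (auto simp: lfront_def lhook_def rfront_def split: if_splits)
      then show thesis using interval[of p q] bnd[of p] bnd[of q] pq by auto
    qed
  qed
qed

end

section \<open>Chips, arcs and counting\<close>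

context cyclic begin

lemma sum_window_class:
  "periodic n g \<Longrightarrow> (\<Sum>j\<in>{w..<w + n}. g j :: int) = (\<Sum>j\<in>{0..<n}. g j)"
  using sum_window[of n g w] n5 by simp

definition chip :: "int \<Rightarrow> int \<Rightarrow> int" where
  "chip c j = of_bool ((j - c) mod n = 0)"

lemma chip_periodic: "periodic n (chip c)"
  using mod_add_self2[of "i - c" n for i] by (simp add: chip_def periodic_def algebra_simps)

lemma chip_near:
  assumes "j - c < n" "c - j < n"
  shows "chip c j = of_bool (j = c)"
proof (cases "c \<le> j")
  case True
  then show ?thesis using assms by (simp add: chip_def)
next
  case False
  then have "(j - c) mod n = (j - c + n) mod n" by simp
  also have "\<dots> = j - c + n" using False assms by (intro mod_pos_pos_trivial) auto
  finally show ?thesis using False assms by (simp add: chip_def)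
qed

lemma chip_add_period [simp]: "chip (c + n) = chip c"
proof
  fix j show "chip (c + n) j = chip c j"
    using minus_mod_self2[of "j - c" n] by (simp add: chip_def diff_diff_eq)
qed

lemma chip_nonneg [simp]: "0 \<le> chip c j"
  by (simp add: chip_def)

lemma chip_shift: "chip c (j + k) = chip (c - k) j"
  by (simp add: chip_def algebra_simps)

lemma lap_chip: "lap (chip c) j = 4 * chip c j - chip (c - 1) j - chip (c + 1) j - chip (c - 2) j - chip (c + 2) j"
  using chip_shift[of c j 1] chip_shift[of c j "-1"] chip_shift[of c j 2] chip_shift[of c j "-2"]
  by (simp add: lap_def)

lemma lap_periodic:
  assumes "periodic n f"
  shows "periodic n (lap f)"
proof -
  have "i + n + 1 = i + 1 + n" "i + n - 1 = i - 1 + n" "i + n + 2 = i + 2 + n" "i + n - 2 = i - 2 + n" for i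
    by simp_all
  then show ?thesis using assms by (simp only: periodic_def lap_def) simp
qed

lemma lap_add: "lap (\<lambda>j. f j + g j) i = lap f i + lap g i"
  by (simp add: lap_def)

lemma lap_diff: "lap (\<lambda>j. f j - g j) i = lap f i - lap g i"
  by (simp add: lap_def)

definition ends :: "int \<Rightarrow> int \<Rightarrow> int \<Rightarrow> int" where
  "ends a b j = 2 * chip a j + chip (a + 1) j + 2 * chip b j + chip (b - 1) j"

definition block :: "int \<Rightarrow> int \<Rightarrow> int \<Rightarrow> int" where
  "block a b j = (\<Sum>c\<in>{a..b}. chip c j)"

lemma block_periodic: "periodic n (block a b)"
  using chip_periodic by (simp add: periodic_def block_def)

text \<open>The subtracted term is the pair of fronts of the complementary arc from
  \<open>b + 1\<close> to \<open>a - 1\<close>, so firing an arc exchanges its fronts for those of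
  the complement. For \<open>a = b\<close> the fronts overlap and the formula still gives the loss
  of 4.\<close>

lemma lap_block:
  assumes "a \<le> b"
  shows "lap (block a b) j = ends a b j - ends (b + 1) (a - 1) j"
  using assms
proof (induction b rule: int_ge_induct)
  case base
  have "block a a = chip a" by (rule ext) (simp add: block_def)
  then show ?case by (simp add: lap_chip ends_def algebra_simps)
next
  case (step b)
  have "{a..b + 1} = insert (b + 1) {a..b}" using step by auto
  then have "block a (b + 1) = (\<lambda>j. block a b j + chip (b + 1) j)"
    by (simp add: block_def fun_eq_iff)
  then show ?case
    using step by (simp add: lap_add lap_chip ends_def algebra_simps)
qed

lemma chip_sum: "(\<Sum>j\<in>{0..<n}. chip c j) = 1"
proof -
  have "(\<Sum>j\<in>{0..<n}. chip c j) = (\<Sum>j\<in>{c..<c + n}. chip c j)"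
    using sum_window_class[OF chip_periodic, of c c] by simp
  also have "\<dots> = (\<Sum>j\<in>{c..<c + n}. if j = c then 1 else 0)"
    by (rule sum.cong) (use n5 in \<open>auto simp: chip_near\<close>)
  finally show ?thesis using n5 by simp
qed

lemma ends_sum: "(\<Sum>j\<in>{0..<n}. ends a b j) = 6"
  by (simp add: ends_def sum.distrib chip_sum flip: sum_distrib_left)

lemma nonneg_if_window:
  fixes F :: "int \<Rightarrow> int"
  assumes "periodic n F" "\<And>j. w \<le> j \<Longrightarrow> j < w + n \<Longrightarrow> 0 \<le> F j"
  shows "0 \<le> F j"
proof -
  have "0 \<le> F (w + (j - w) mod n)"
    using n5 by (intro assms(2)) auto
  then show ?thesis using periodic_mod[OF assms(1)] by simp
qed

lemma periodic_add: "periodic n f \<Longrightarrow> periodic n g \<Longrightarrow> periodic n (\<lambda>j. f j + g j :: int)"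
  by (simp add: periodic_def)

lemma ends_periodic: "periodic n (ends a b)"
  using chip_periodic by (simp add: periodic_def ends_def)

end

context positive_rank_class begin

lemma sum_remainder:
  fixes F g :: "int \<Rightarrow> int"
  assumes D: "D \<in> C" and F: "\<And>j. D j = F j + g j" and F0: "\<And>j. 0 \<le> F j"
    and g: "periodic n g" "(\<Sum>j\<in>{0..<n}. g j) = k" and S: "S \<subseteq> {w..<w + n}"
  shows "(\<Sum>j\<in>S. F j) \<le> d - k"
proof -
  have "(\<Sum>j\<in>S. F j) \<le> (\<Sum>j\<in>{w..<w + n}. F j)"
    using S F0 by (intro sum_mono2) auto
  also have "\<dots> = (\<Sum>j\<in>{w..<w + n}. D j) - (\<Sum>j\<in>{w..<w + n}. g j)"
    by (simp add: F sum.distrib)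
  also have "\<dots> = d - k"
    using degree_window[OF D] sum_window_class[OF g(1)] g(2) by simp
  finally show ?thesis .
qed

lemma fire_block:
  assumes "D \<in> C" "D = (\<lambda>j. E j + ends a b j)" "\<And>j. 0 \<le> E j" "a \<le> b"
  shows "(\<lambda>j. E j + ends (b + 1) (a - 1) j) \<in> C"
proof -
  have nn: "0 \<le> ends c e j" for c e j by (simp add: ends_def)
  have "(\<lambda>j. D j - lap (block a b) j) \<in> C"
  proof (rule fire[OF assms(1) block_periodic])
    show "lap (block a b) j \<le> D j" for j
      using assms(3)[of j] nn[of "b + 1" "a - 1" j] by (simp add: lap_block[OF assms(4)] assms(2))
  qed
  then show ?thesis by (simp add: lap_block[OF assms(4)] assms(2))
qed

text \<open>Interpreting the locale for the reflected class turns every one-sided lemma into its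
  mirror image.\<close>

lemma reflect: "positive_rank_class n d ((\<lambda>D i. D (- i)) ` C)"
proof
  show "(\<lambda>D i. D (- i)) ` C \<noteq> {}" using nonempty by simp
  have lap_refl: "lap (\<lambda>i. f (- i)) i = lap f (- i)" for f i
  proof -
    have "- (i + 1) = - i - 1" "- (i - 1) = - i + 1" "- (i + 2) = - i - 2" "- (i - 2) = - i + 2"
      by simp_all
    then show ?thesis unfolding lap_def by (simp only:)
  qed
  have per_refl: "periodic n (\<lambda>i. f (- i))" if "periodic n f" for f :: "int \<Rightarrow> int"
    using periodic_minus[OF that] by (simp add: periodic_def)
  fix D assume "D \<in> (\<lambda>D i. D (- i)) ` C"
  then obtain D' where D': "D' \<in> C" "D = (\<lambda>i. D' (- i))" by blast
  show "periodic n D" using D' per per_refl by simp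
  show "0 \<le> D i" for i using D' nonneg by simp
  have "(\<Sum>j\<in>{0..<n}. D j) = (\<Sum>j\<in>{1 - n..<1 - n + n}. D' j)"
    by (rule sum.reindex_bij_witness[of _ uminus uminus]) (auto simp: D')
  then show "(\<Sum>j\<in>{0..<n}. D j) = d" using degree_window[OF D'(1), of "1 - n"] by simp
  show "(\<lambda>i. D i - lap f i) \<in> (\<lambda>D i. D (- i)) ` C"
    if "periodic n f" "\<And>i. lap f i \<le> D i" for f
  proof -
    have "(\<lambda>i. D' i - lap (\<lambda>i. f (- i)) i) \<in> C"
    proof (rule fire[OF D'(1) per_refl[OF that(1)]])
      show "lap (\<lambda>i. f (- i)) i \<le> D' i" for i
        using that(2)[of "- i"] by (simp add: D' lap_refl)
    qed
    then show ?thesis by (rule rev_image_eqI) (simp add: lap_refl D')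
  qed
  show "\<exists>f. periodic n f \<and> (\<lambda>i. D i - lap f i) \<in> (\<lambda>D i. D (- i)) ` C \<and> 1 \<le> D x - lap f x" for x
  proof -
    obtain f where f: "periodic n f" "(\<lambda>i. D' i - lap f i) \<in> C" "1 \<le> D' (- x) - lap f (- x)"
      using reach[OF D'(1)] by blast
    have "(\<lambda>i. D i - lap (\<lambda>i. f (- i)) i) \<in> (\<lambda>D i. D (- i)) ` C"
      using f(2) by (rule rev_image_eqI) (simp add: lap_refl D')
    then show ?thesis
      using f per_refl[OF f(1)] by (intro exI[of _ "\<lambda>i. f (- i)"]) (simp add: lap_refl D')
  qed
qed

end

section \<open>Discharging along stretches without slack\<close>

definition zero_flow :: "(int \<Rightarrow> int) \<Rightarrow> int \<Rightarrow> int" where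
  "zero_flow D i = (if D i = 0 then 1 else if D (i + 1) = 0 then -1 else 0)"

text \<open>Discharging: position \<open>i\<close> carries \<open>3 * D i - 2\<close> and every zero receives 1 from each
  neighbour; \<open>zero_flow D i\<close> is what passes from \<open>i + 1\<close> to \<open>i\<close>.\<close>

lemma count_no_slack_flow:
  fixes D :: "int \<Rightarrow> int"
  assumes "s \<le> t + 1" and nn: "\<And>i. 0 \<le> D i" and ns: "\<And>i. s \<le> i \<Longrightarrow> i \<le> t \<Longrightarrow> \<not> slack D i"
    and left: "D (s - 1) \<noteq> 0"
  shows "2 * (t - s + 1) + zero_flow D (s - 1) - zero_flow D t \<le> 3 * (\<Sum>i\<in>{s..t}. D i)"
proof -
  have "2 * (k - s + 1) + zero_flow D (s - 1) - zero_flow D k \<le> 3 * (\<Sum>i\<in>{s..k}. D i)"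
    if "s - 1 \<le> k" "k \<le> t" for k
    using that
  proof (induction k rule: int_ge_induct)
    case (step k)
    have "{s..k + 1} = insert (k + 1) {s..k}" using step(1) by auto
    then have sum: "(\<Sum>i\<in>{s..k + 1}. D i) = D (k + 1) + (\<Sum>i\<in>{s..k}. D i)" by simp
    have prev: "\<not> slack D k" if "D k = 0"
      using ns[of k] left step that by (cases "k = s - 1") auto
    \<comment> \<open>A zero is paid by both neighbours because neither of them is zero. A lone chip
      has surplus 1 and pays only one zero, as zeros on both sides would make \<open>k\<close>
      slack. Two chips have surplus 4 and can pay both sides.\<close>
    have "2 + zero_flow D k - zero_flow D (k + 1) \<le> 3 * D (k + 1)"
      using ns[of "k + 1"] prev nn[of "k + 1"] step(1,3)
      by (auto simp: zero_flow_def slack_def algebra_simps)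
    then show ?case using step sum by simp
  qed simp
  from this[of t] show ?thesis using assms(1) by simp
qed

text \<open>At most one unit flows out across either end of the stretch, hence the 2.\<close>

lemma count_no_slack:
  fixes D :: "int \<Rightarrow> int"
  assumes "s \<le> t + 1" "\<And>i. 0 \<le> D i" "\<And>i. s \<le> i \<Longrightarrow> i \<le> t \<Longrightarrow> \<not> slack D i" "D (s - 1) \<noteq> 0"
  shows "2 * (t - s + 1) \<le> 3 * (\<Sum>i\<in>{s..t}. D i) + 2"
  using count_no_slack_flow[OF assms] by (auto simp: zero_flow_def split: if_splits)

section \<open>Arcs with a hook\<close>

text \<open>Seen from \<open>i\<close>, the right hook at \<open>b\<close> precedes the left front
  at \<open>a\<close>, the wrong order for an arc avoiding \<open>i\<close>. Forming both a left and
  a right end would take at least two chips beyond the hook and the front, and \<open>F\<close> has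
  at most one.\<close>

lemma hook_no_interval:
  fixes D F :: "int \<Rightarrow> int"
  assumes win: "\<And>j. i \<le> j \<Longrightarrow> j < i + n \<Longrightarrow> D j = F j + rhook b j + lfront a j"
    and F0: "\<And>j. 0 \<le> F j"
    and F1: "\<And>x y. i \<le> x \<Longrightarrow> x < y \<Longrightarrow> y < i + n \<Longrightarrow> F x + F y \<le> 1"
    and ord: "i + 4 \<le> b" "b + 3 \<le> a" "a + 2 \<le> i + n" and Fb: "F (b - 1) = 0" "F b = 0"
    and pq: "i + 2 \<le> p" "p < q" "q < i + n" and pat: "\<And>j. lfront p j + rfront q j \<le> D j"
  shows False
proof -
  have F1': "F x \<le> 1" if "i \<le> x" "x < i + n" for x
    using F1[of x "x + 1"] F1[of "x - 1" x] F0[of "x + 1"] F0[of "x - 1"] that ord by smt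
  have v: "D p = F p + rhook b p + lfront a p" "D (p + 1) = F (p + 1) + rhook b (p + 1) + lfront a (p + 1)"
    "D q = F q + rhook b q + lfront a q" "D (q - 1) = F (q - 1) + rhook b (q - 1) + lfront a (q - 1)"
    using pq by (intro win; simp)+
  have s: "F p + F q \<le> 1" "p + 1 < q \<Longrightarrow> F (p + 1) + F q \<le> 1" "F p + F (p + 1) \<le> 1" "F (q - 1) + F q \<le> 1"
    "p < q - 1 \<Longrightarrow> F p + F (q - 1) \<le> 1" "p + 1 < q - 1 \<Longrightarrow> F (p + 1) + F (q - 1) \<le> 1"
    "F p \<le> 1" "F q \<le> 1" "F (p + 1) \<le> 1" "F (q - 1) \<le> 1"
    using F1[of p q] F1[of "p + 1" q] F1[of p "p + 1"] F1[of "q - 1" q] F1[of p "q - 1"]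
      F1[of "p + 1" "q - 1"] F1' pq by auto
  show False
    using v s pat[of p] pat[of "p + 1"] pat[of q] pat[of "q - 1"] ord Fb pq
      F0[of p] F0[of "p + 1"] F0[of q] F0[of "q - 1"]
    unfolding lfront_def rfront_def rhook_def by (smt (z3))
qed

text \<open>Since \<open>b + 3 \<le> a\<close>, the hook and the front put at most 4 chips on two
  vertices two apart and at most 5 on the three vertices of a triple. One chip of \<open>F\<close>
  does not raise this to the required 6 or 8.\<close>

lemma hook_no_pair:
  fixes D F :: "int \<Rightarrow> int"
  assumes win: "\<And>j. i \<le> j \<Longrightarrow> j < i + n \<Longrightarrow> D j = F j + rhook b j + lfront a j"
    and F0: "\<And>j. 0 \<le> F j"
    and F1: "\<And>x y. i \<le> x \<Longrightarrow> x < y \<Longrightarrow> y < i + n \<Longrightarrow> F x + F y \<le> 1"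
    and ord: "i + 4 \<le> b" "b + 3 \<le> a" "a + 2 \<le> i + n" and Fb: "F (b - 1) = 0" "F b = 0"
    and pq: "i + 2 \<le> p" "p + k < i + n" "k \<ge> 2" and pat: "D p = 3" "D (p + k) = 3"
      "k = 2 \<or> k = 4 \<and> 2 \<le> D (p + 2)"
  shows False
proof -
  have v: "D p = F p + rhook b p + lfront a p" "D (p + k) = F (p + k) + rhook b (p + k) + lfront a (p + k)"
    "D (p + 2) = F (p + 2) + rhook b (p + 2) + lfront a (p + 2)"
    using pq by (intro win; simp)+
  have s: "F p + F (p + k) \<le> 1" "k = 4 \<Longrightarrow> F p + F (p + 2) \<le> 1" "k = 4 \<Longrightarrow> F (p + 2) + F (p + k) \<le> 1"
    using F1[of p "p + k"] F1[of p "p + 2"] F1[of "p + 2" "p + k"] pq by auto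
  show False
    using v s pat ord Fb pq F0[of p] F0[of "p + k"] F0[of "p + 2"]
    unfolding lfront_def rfront_def rhook_def by (smt (z3))
qed

lemma hook_no_right_hook:
  fixes D F :: "int \<Rightarrow> int"
  assumes win: "\<And>j. i \<le> j \<Longrightarrow> j < i + n \<Longrightarrow> D j = F j + rhook b j + lfront a j"
    and F0: "\<And>j. 0 \<le> F j"
    and F1: "\<And>x y. i \<le> x \<Longrightarrow> x < y \<Longrightarrow> y < i + n \<Longrightarrow> F x + F y \<le> 1"
    and ord: "i + 4 \<le> b" "b + 3 \<le> a" "a + 2 \<le> i + n" and Fb: "F (b - 1) = 0" "F b = 0"
    and pq: "i + 2 \<le> p" "p + 3 \<le> q" "q < i + n" and pat: "\<And>j. lfront p j + rhook q j \<le> D j"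
  shows False
proof -
  have v: "D p = F p + rhook b p + lfront a p" "D (p + 1) = F (p + 1) + rhook b (p + 1) + lfront a (p + 1)"
    "D q = F q + rhook b q + lfront a q" "D (q - 2) = F (q - 2) + rhook b (q - 2) + lfront a (q - 2)"
    "D (q - 3) = F (q - 3) + rhook b (q - 3) + lfront a (q - 3)"
    using pq by (intro win; simp)+
  have s: "F p + F q \<le> 1" "F (p + 1) + F q \<le> 1" "F p + F (p + 1) \<le> 1" "F (q - 2) + F q \<le> 1"
     "F (q - 3) + F q \<le> 1" "F (q - 3) + F (q - 2) \<le> 1"
    using F1[of p q] F1[of "p + 1" q] F1[of p "p + 1"] F1[of "q - 2" q] F1[of "q - 3" q]
      F1[of "q - 3" "q - 2"] pq by auto
  show False
    using v s pat[of p] pat[of "p + 1"] pat[of q] pat[of "q - 2"] pat[of "q - 3"] ord Fb pq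
      F0[of p] F0[of "p + 1"] F0[of q] F0[of "q - 2"] F0[of "q - 3"]
    unfolding lfront_def rfront_def rhook_def by (smt (z3))
qed

lemma hook_no_left_hook:
  fixes D F :: "int \<Rightarrow> int"
  assumes win: "\<And>j. i \<le> j \<Longrightarrow> j < i + n \<Longrightarrow> D j = F j + rhook b j + lfront a j"
    and F0: "\<And>j. 0 \<le> F j"
    and F1: "\<And>x y. i \<le> x \<Longrightarrow> x < y \<Longrightarrow> y < i + n \<Longrightarrow> F x + F y \<le> 1"
    and ord: "i + 4 \<le> b" "b + 3 \<le> a" "a + 2 \<le> i + n" and Fb: "F (b - 1) = 0" "F b = 0"
    and pq: "i + 2 \<le> p" "p + 3 \<le> q" "q < i + n" and pat: "\<And>j. lhook p j + rfront q j \<le> D j"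
  shows False
proof -
  have v: "D p = F p + rhook b p + lfront a p" "D (p + 2) = F (p + 2) + rhook b (p + 2) + lfront a (p + 2)"
    "D (p + 3) = F (p + 3) + rhook b (p + 3) + lfront a (p + 3)"
    "D q = F q + rhook b q + lfront a q" "D (q - 1) = F (q - 1) + rhook b (q - 1) + lfront a (q - 1)"
    using pq by (intro win; simp)+
  have s: "F p + F q \<le> 1" "F p + F (p + 2) \<le> 1" "F p + F (p + 3) \<le> 1" "F (q - 1) + F q \<le> 1"
     "F (p + 2) + F (p + 3) \<le> 1" "F (p + 2) + F q \<le> 1"
    using F1[of p q] F1[of p "p + 2"] F1[of p "p + 3"] F1[of "q - 1" q] F1[of "p + 2" "p + 3"]
      F1[of "p + 2" q] pq by auto
  show False
    using v s pat[of p] pat[of "p + 2"] pat[of "p + 3"] pat[of q] pat[of "q - 1"] ord Fb pq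
      F0[of p] F0[of "p + 2"] F0[of "p + 3"] F0[of q] F0[of "q - 1"]
    unfolding lfront_def rfront_def rhook_def lhook_def by (smt (z3))
qed

text \<open>The ways in which free chips complete the right front (1 on \<open>b - 1\<close>, 2 on
  \<open>b\<close>) to a left front, which then starts at \<open>b\<close>, \<open>b - 1\<close> or
  \<open>b - 2\<close> respectively.\<close>

definition right_room :: "(int \<Rightarrow> int) \<Rightarrow> int \<Rightarrow> bool" where
  "right_room E b \<longleftrightarrow> 1 \<le> E (b + 1) \<or> 1 \<le> E (b - 1) \<or> 2 \<le> E (b - 2)"

definition left_room :: "(int \<Rightarrow> int) \<Rightarrow> int \<Rightarrow> bool" where
  "left_room E a \<longleftrightarrow> 1 \<le> E (a - 1) \<or> 1 \<le> E (a + 1) \<or> 2 \<le> E (a + 2)"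

text \<open>An arc avoiding \<open>i\<close> meets the right front \<open>b\<close> before the left
  front \<open>a\<close>. Either it turns both fronts around, which is what room means, or it keeps
  one of them as its own end and builds the other end from three free chips.\<close>

lemma state_interval:
  fixes D E :: "int \<Rightarrow> int"
  assumes win: "\<And>j. i \<le> j \<Longrightarrow> j < i + n \<Longrightarrow> D j = E j + lfront a j + rfront b j"
    and E0: "\<And>j. 0 \<le> E j"
    and E3: "\<And>x y. i \<le> x \<Longrightarrow> x < y \<Longrightarrow> y < i + n \<Longrightarrow> E x + E y \<le> 3"
      "\<And>x y z. i \<le> x \<Longrightarrow> x < y \<Longrightarrow> y < z \<Longrightarrow> z < i + n \<Longrightarrow> E x + E y + E z \<le> 3"
      "\<And>x y z w. i \<le> x \<Longrightarrow> x < y \<Longrightarrow> y < z \<Longrightarrow> z < w \<Longrightarrow> w < i + n \<Longrightarrow> E x + E y + E z + E w \<le> 3"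
    and ord: "i + 2 \<le> b" "b + 3 \<le> a" "a + 2 \<le> i + n"
    and ends: "E a \<le> 1" "E b \<le> 1" "E (a - 1) \<le> 1" "E (b + 1) \<le> 1"
    and pq: "i + 2 \<le> p" "p < q" "q < i + n" and pat: "\<And>j. lfront p j + rfront q j \<le> D j"
  shows "right_room E b \<and> left_room E a \<or> p < b \<and> q = b \<and> 2 \<le> E p \<and> 1 \<le> E (p + 1)
    \<or> p = a \<and> a < q \<and> 2 \<le> E q \<and> 1 \<le> E (q - 1)"
proof -
  have v: "D p = E p + lfront a p + rfront b p" "D (p + 1) = E (p + 1) + lfront a (p + 1) + rfront b (p + 1)"
    "D q = E q + lfront a q + rfront b q" "D (q - 1) = E (q - 1) + lfront a (q - 1) + rfront b (q - 1)"
    using pq by (intro win; simp)+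
  note pt = pat[of p] pat[of "p + 1"] pat[of q] pat[of "q - 1"]
  note z = E0[of p] E0[of "p + 1"] E0[of q] E0[of "q - 1"]
  \<comment> \<open>All places for the left end, each with the free chips it consumes;
    \<open>Q\<close> does the same for the right end. The sums below discard the pairs that need
    more than three.\<close>
  have P: "p \<le> b - 3 \<and> 2 \<le> E p \<and> 1 \<le> E (p + 1) \<or> p = b - 2 \<and> 2 \<le> E p \<or> p = b - 1 \<and> 1 \<le> E p
      \<or> p = b \<and> 1 \<le> E (b + 1) \<or> b + 2 \<le> p \<and> p \<le> a - 2 \<and> 2 \<le> E p \<and> 1 \<le> E (p + 1)
      \<or> p = a \<or> p = a + 1 \<and> 1 \<le> E (a + 1) \<and> 1 \<le> E (a + 2) \<or> a + 2 \<le> p \<and> 2 \<le> E p \<and> 1 \<le> E (p + 1)"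
    using v(1,2) pt(1,2) z(1,2) ord ends pq unfolding lfront_def rfront_def by (smt (verit))
  have Q: "a + 3 \<le> q \<and> 2 \<le> E q \<and> 1 \<le> E (q - 1) \<or> q = a + 2 \<and> 2 \<le> E q \<or> q = a + 1 \<and> 1 \<le> E q
      \<or> q = a \<and> 1 \<le> E (a - 1) \<or> b + 2 \<le> q \<and> q \<le> a - 2 \<and> 2 \<le> E q \<and> 1 \<le> E (q - 1)
      \<or> q = b \<or> q = b - 1 \<and> 1 \<le> E (b - 1) \<and> 1 \<le> E (b - 2) \<or> q \<le> b - 2 \<and> 2 \<le> E q \<and> 1 \<le> E (q - 1)"
    using v(3,4) pt(3,4) z(3,4) ord ends pq unfolding lfront_def rfront_def by (smt (verit))
  have s2: "E p + E q \<le> 3" "E p + E (p + 1) \<le> 3" "E (q - 1) + E q \<le> 3"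
    using E3(1)[of p q] E3(1)[of p "p + 1"] E3(1)[of "q - 1" q] pq by auto
  have s4: "p + 1 < q - 1 \<Longrightarrow> E p + E (p + 1) + E (q - 1) + E q \<le> 3"
    using E3(3)[of p "p + 1" "q - 1" q] pq by auto
  have s3: "p < q - 1 \<Longrightarrow> E p + E (q - 1) + E q \<le> 3" "p + 1 < q \<Longrightarrow> E p + E (p + 1) + E q \<le> 3"
    using E3(2)[of p "q - 1" q] E3(2)[of p "p + 1" q] pq by auto
  have sb: "b + 1 < q - 1 \<Longrightarrow> E (b + 1) + E (q - 1) + E q \<le> 3" "p + 1 < a - 1 \<Longrightarrow> E p + E (p + 1) + E (a - 1) \<le> 3"
    using E3(2)[of "b + 1" "q - 1" q] E3(2)[of p "p + 1" "a - 1"] pq ord by auto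
  show ?thesis
  proof (cases "p \<le> b \<and> a \<le> q")
    case True
    then have "right_room E b \<or> p \<le> b - 3 \<and> 2 \<le> E p \<and> 1 \<le> E (p + 1)"
      using P ord unfolding right_room_def by auto
    moreover have "left_room E a \<or> a + 3 \<le> q \<and> 2 \<le> E q \<and> 1 \<le> E (q - 1)"
      using Q True ord unfolding left_room_def by auto
    moreover have "\<not> (p \<le> b - 3 \<and> 2 \<le> E p \<and> 1 \<le> E (p + 1))"
      using E3(2)[of p "p + 1" q] E3(2)[of p "p + 1" "a - 1"] Q True ord pq z by (smt (verit))
    moreover have "\<not> (a + 3 \<le> q \<and> 2 \<le> E q \<and> 1 \<le> E (q - 1))"
      using E3(2)[of p "q - 1" q] E3(2)[of "b + 1" "q - 1" q] P True ord pq z by (smt (verit))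
    ultimately show ?thesis by blast
  next
    case False
    show ?thesis
      using False P Q v pt z s2 s3 s4 sb ord ends pq unfolding lfront_def rfront_def by (smt (z3))
  qed
qed

text \<open>As \<open>b + 3 \<le> a\<close>, the fronts give at most 2 chips to two vertices two
  apart and at most 4 to the three vertices of a triple. With three free chips this stays below 6
  and 8.\<close>

lemma state_no_pair:
  fixes D E :: "int \<Rightarrow> int"
  assumes win: "\<And>j. i \<le> j \<Longrightarrow> j < i + n \<Longrightarrow> D j = E j + lfront a j + rfront b j"
    and E0: "\<And>j. 0 \<le> E j"
    and E3: "\<And>x y. i \<le> x \<Longrightarrow> x < y \<Longrightarrow> y < i + n \<Longrightarrow> E x + E y \<le> 3"
      "\<And>x y z. i \<le> x \<Longrightarrow> x < y \<Longrightarrow> y < z \<Longrightarrow> z < i + n \<Longrightarrow> E x + E y + E z \<le> 3"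
    and ord: "i + 2 \<le> b" "b + 3 \<le> a" "a + 2 \<le> i + n"
    and pq: "i + 2 \<le> p" "p + k < i + n" "k \<ge> 2" and pat: "D p = 3" "D (p + k) = 3"
      "k = 2 \<and> D (p + 1) \<le> 1 \<or> k = 4 \<and> 2 \<le> D (p + 2)"
  shows False
proof -
  have v: "D p = E p + lfront a p + rfront b p" "D (p + k) = E (p + k) + lfront a (p + k) + rfront b (p + k)"
    "D (p + 2) = E (p + 2) + lfront a (p + 2) + rfront b (p + 2)"
    "D (p + 1) = E (p + 1) + lfront a (p + 1) + rfront b (p + 1)"
    using pq by (intro win; simp)+
  have s: "E p + E (p + k) \<le> 3" "k = 4 \<Longrightarrow> E p + E (p + 2) + E (p + k) \<le> 3"
    "E p + E (p + 1) + E (p + k) \<le> 3"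
    using E3(1)[of p "p + k"] E3(2)[of p "p + 2" "p + k"] E3(2)[of p "p + 1" "p + k"] pq by auto
  show False
    using v s pat ord pq E0[of p] E0[of "p + k"] E0[of "p + 2"] E0[of "p + 1"]
    unfolding lfront_def rfront_def by (smt (z3))
qed

lemma front_sums:
  "lfront p j = 2 * of_bool (j = p) + of_bool (j = p + 1)"
  "rfront p j = 2 * of_bool (j = p) + of_bool (j = p - 1)"
  "lhook p j = 3 * of_bool (j = p) + of_bool (j = p + 2) + of_bool (j = p + 3)"
  "rhook p j = 3 * of_bool (j = p) + of_bool (j = p - 2) + of_bool (j = p - 3)"
  by (auto simp: lfront_def rfront_def rhook_def lhook_def)

lemma reflect_fronts:
  "lfront (- q) (- j) = rfront q j" "rfront (- p) (- j) = lfront p j" "rhook (- p) (- j) = lhook p j"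
  by (auto simp: lfront_def rfront_def rhook_def lhook_def)

text \<open>The patterns 00 and 010 are palindromes, so the mirror image is slack at the reflected
  other end.\<close>

lemma slack_reflect:
  assumes "slack D i"
  obtains i' where "slack (\<lambda>j. D (- j)) i'" "i' = - i - 1 \<and> D (i + 1) = 0 \<or> i' = - i - 2 \<and> D (i + 2) = 0"
proof (cases "D (i + 1) = 0")
  case True
  then have "slack (\<lambda>j. D (- j)) (- i - 1)"
    using assms by (simp add: slack_def add.commute)
  then show thesis using that True by blast
next
  case False
  then have "D (i + 1) = 1" "D (i + 2) = 0" using assms by (auto simp: slack_def)
  moreover have "- (- i - 2) = i + 2" "- (- i - 2 + 1) = i + 1" "- (- i - 2 + 2) = i" by simp_all
  ultimately have "slack (\<lambda>j. D (- j)) (- i - 2)"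
    using assms unfolding slack_def by metis
  then show thesis using that \<open>D (i + 2) = 0\<close> by blast
qed

section \<open>Excluding arcs with a hook\<close>

context positive_rank_class begin

lemma chip_uminus: "chip c (- j) = chip (- c) j"
proof -
  have "- j - c = - (j - (- c))" by simp
  then have "n dvd - j - c \<longleftrightarrow> n dvd j - (- c)" by (simp only: dvd_minus_iff)
  then show ?thesis by (simp add: chip_def mod_eq_0_iff_dvd)
qed

definition hook :: "int \<Rightarrow> int \<Rightarrow> int \<Rightarrow> int" where
  "hook p q j = 2 * chip p j + chip (p + 1) j + 3 * chip q j + chip (q - 2) j + chip (q - 3) j"

lemma hook_periodic: "periodic n (hook p q)"
  using chip_periodic by (simp add: periodic_def hook_def)

lemma hook_sum: "(\<Sum>j\<in>{0..<n}. hook p q j) = 8"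
  by (simp add: hook_def sum.distrib chip_sum flip: sum_distrib_left)

lemma hook_nonneg: "0 \<le> hook p q j"
  by (simp add: hook_def)

lemma hook_window:
  assumes "w \<le> j" "j < w + n" "w \<le> p" "p + 1 < w + n" "w \<le> q - 3" "q < w + n"
  shows "hook p q j = lfront p j + rhook q j"
proof -
  have "chip p j = of_bool (j = p)" "chip (p + 1) j = of_bool (j = p + 1)" "chip q j = of_bool (j = q)"
    "chip (q - 2) j = of_bool (j = q - 2)" "chip (q - 3) j = of_bool (j = q - 3)"
    using assms by (intro chip_near; linarith)+
  then show ?thesis by (simp add: hook_def front_sums)
qed

lemma ends_window:
  assumes "w \<le> j" "j < w + n" "w \<le> a" "a + 1 < w + n" "w \<le> b - 1" "b < w + n"
  shows "ends a b j = lfront a j + rfront b j"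
proof -
  have "chip a j = of_bool (j = a)" "chip (a + 1) j = of_bool (j = a + 1)" "chip b j = of_bool (j = b)"
    "chip (b - 1) j = of_bool (j = b - 1)"
    using assms by (intro chip_near; linarith)+
  then show ?thesis by (simp add: ends_def front_sums)
qed

lemma ends_add_period: "ends (a + n) b = ends a b" "ends a (b + n) = ends a b"
proof -
  have "chip (a + n + 1) = chip (a + 1)" "chip (b + n - 1) = chip (b - 1)"
    using chip_add_period[of "a + 1"] chip_add_period[of "b - 1"] by (simp_all add: algebra_simps)
  then show "ends (a + n) b = ends a b" "ends a (b + n) = ends a b"
    by (simp_all add: ends_def fun_eq_iff)
qed

lemma hook_add_period: "hook (p + n) q = hook p q"
proof -
  have "chip (p + n + 1) = chip (p + 1)"
    using chip_add_period[of "p + 1"] by (simp add: algebra_simps)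
  then show ?thesis by (simp add: hook_def fun_eq_iff)
qed

text \<open>A slack zero inside the fired set calls for a second legal set. The hook and its
  opposite front bind eight chips, and the one that may remain completes no pattern.\<close>

lemma hook_dead:
  assumes D: "D \<in> C" and d9: "d \<le> 9" and flat: "\<And>j. D j \<le> 3"
    and F: "D = (\<lambda>j. F j + hook p q j)" and F0: "\<And>j. 0 \<le> F j" and hole: "F (q - 1) = 0"
    and slack: "slack D i" and ord: "p + 2 \<le> i" "i + 4 \<le> q" "q + 3 \<le> p + n"
  shows False
proof -
  have Fs: "(\<Sum>j\<in>S. F j) \<le> 1" if "S \<subseteq> {i..<i + n}" for S
    using sum_remainder[OF D, of F "hook p q" 8, OF _ F0 hook_periodic hook_sum that] F d9 by simp
  have F1: "F x + F y \<le> 1" if "i \<le> x" "x < y" "y < i + n" for x y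
    using Fs[of "{x, y}"] that by simp
  have win: "D j = F j + rhook q j + lfront (p + n) j" if "i \<le> j" "j < i + n" for j
    using hook_window[of i j "p + n" q] that ord by (simp add: F hook_add_period)
  have Fq: "F q = 0"
    using flat[of q] win[of q] F0[of q] ord by (simp add: rhook_def lfront_def split: if_splits)
  have ord': "i + 4 \<le> q" "q + 3 \<le> p + n" "p + n + 2 \<le> i + n" using ord by auto
  show False
  proof (rule legal_pattern[OF D d9 flat slack])
    fix p' q' assume "i + 2 \<le> p'" "p' < q'" "q' < i + n" "\<And>j. lfront p' j + rfront q' j \<le> D j"
    from hook_no_interval[of i n D F q "p + n" p' q', OF win F0 F1 ord' hole Fq this] show False by simp
  next
    fix p' assume "i + 2 \<le> p'" "p' + 2 < i + n" "D p' = 3" "D (p' + 2) = 3"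
    then show False using hook_no_pair[OF win F0 F1 ord' hole Fq, of p' 2] by simp
  next
    fix p' assume "i + 2 \<le> p'" "p' + 4 < i + n" "D p' = 3" "2 \<le> D (p' + 2)" "D (p' + 4) = 3"
    then show False using hook_no_pair[OF win F0 F1 ord' hole Fq, of p' 4] by simp
  next
    fix p' q' assume "i + 2 \<le> p'" "p' + 3 \<le> q'" "q' < i + n" "\<And>j. lfront p' j + rhook q' j \<le> D j"
    from hook_no_right_hook[of i n D F q "p + n" p' q', OF win F0 F1 ord' hole Fq this] show False by simp
  next
    fix p' q' assume "i + 2 \<le> p'" "p' + 3 \<le> q'" "q' < i + n" "\<And>j. lhook p' j + rfront q' j \<le> D j"
    from hook_no_left_hook[of i n D F q "p + n" p' q', OF win F0 F1 ord' hole Fq this] show False by simp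
  qed
qed

text \<open>Firing the pattern produces its mirror image around the complement. By
  \<open>hook_dead\<close> there is no slack inside before firing and, reflected, none outside after
  firing. Discharging both stretches gives \<open>2 * n \<le> 24 + 3 * (d - 8)\<close>.\<close>

lemma no_right_hook:
  assumes D: "D \<in> C" and d9: "d \<le> 9" and flat: "\<And>j. D j \<le> 3"
    and pat: "\<And>j. lfront p j + rhook q j \<le> D j" and hole: "D (q - 1) = 0"
    and ord: "p + 3 \<le> q" "q + 3 \<le> p + n" and large: "d = 8 \<Longrightarrow> 15 \<le> n" "d = 9 \<Longrightarrow> 16 \<le> n"
  shows False
proof -
  define F where "F j = D j - hook p q j" for j
  have perF: "periodic n F"
    using per[OF D] hook_periodic by (simp add: periodic_def F_def)
  have F0: "0 \<le> F j" for j
  proof (rule nonneg_if_window[OF perF])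
    show "0 \<le> F j" if "p \<le> j" "j < p + n" for j
      using hook_window[of p j p q] that ord pat[of j] by (simp add: F_def)
  qed
  have DF: "D = (\<lambda>j. F j + hook p q j)" by (simp add: F_def)
  have Fs: "(\<Sum>j\<in>S. F j) \<le> d - 8" if "S \<subseteq> {p..<p + n}" for S
    using sum_remainder[OF D, of F "hook p q" 8, OF _ F0 hook_periodic hook_sum that] DF by simp
  have d8: "8 \<le> d" using Fs[of "{}"] by simp
  have F1: "F j \<le> d - 8" if "p \<le> j" "j < p + n" for j
    using Fs[of "{j}"] that by simp
  have hole': "F (q - 1) = 0" using F0[of "q - 1"] hole hook_nonneg[of p q "q - 1"] by (simp add: F_def)
  have Fq: "F q = 0"
    using flat[of q] hook_window[of p q p q] F0[of q] ord by (simp add: F_def lfront_def rhook_def)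
  have inner: "\<not> slack D i" if "p + 2 \<le> i" "i \<le> q - 4" for i
    using hook_dead[OF D d9 flat DF F0 hole', of i] that ord by auto
  \<comment> \<open>The result of firing \<open>{p..q} - {q - 1}\<close>. The hole receives a chip
    from each of \<open>q\<close>, \<open>q - 2\<close>, \<open>q - 3\<close> and becomes the head
    of a left hook.\<close>
  define D1 where "D1 j = F j + 2 * chip (p - 1) j + chip (p - 2) j + 3 * chip (q - 1) j + chip (q + 1) j + chip (q + 2) j" for j
  have lapf: "lap (\<lambda>j. block p q j - chip (q - 1) j) j = D j - D1 j" for j
    using lap_block[of p q j] ord
    by (simp add: lap_diff lap_chip ends_def F_def D1_def hook_def algebra_simps)
  have "(\<lambda>j. D j - lap (\<lambda>j. block p q j - chip (q - 1) j) j) \<in> C"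
  proof (rule fire[OF D])
    show "periodic n (\<lambda>j. block p q j - chip (q - 1) j)"
      using block_periodic chip_periodic by (simp add: periodic_def)
    show "lap (\<lambda>j. block p q j - chip (q - 1) j) i \<le> D i" for i
      using F0[of i] chip_nonneg[of "p - 1" i] chip_nonneg[of "p - 2" i] chip_nonneg[of "q - 1" i]
        chip_nonneg[of "q + 1" i] chip_nonneg[of "q + 2" i]
      unfolding lapf D1_def by linarith
  qed
  then have D1: "D1 \<in> C" by (simp add: lapf)
  have D1w: "D1 j = F j + lhook (q - 1) j + rfront (p + n - 1) j" if "q - 1 \<le> j" "j < q - 1 + n" for j
  proof -
    have "chip (p - 1) = chip (p + n - 1)" "chip (p - 2) = chip (p + n - 2)"
      using chip_add_period[of "p - 1"] chip_add_period[of "p - 2"] by (simp_all add: algebra_simps)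
    moreover have "chip (p + n - 1) j = of_bool (j = p + n - 1)" "chip (p + n - 2) j = of_bool (j = p + n - 2)"
      "chip (q - 1) j = of_bool (j = q - 1)" "chip (q + 1) j = of_bool (j = q + 1)" "chip (q + 2) j = of_bool (j = q + 2)"
      using that ord by (intro chip_near; linarith)+
    ultimately show ?thesis by (simp add: D1_def front_sums)
  qed
  have outer: "\<not> slack D1 i" if i: "q + 3 \<le> i" "i \<le> p + n - 3" for i
  proof
    assume sl: "slack D1 i"
    have flat1: "D1 j \<le> 3" for j
    proof -
      have "0 \<le> 3 - D1 j"
      proof (rule nonneg_if_window[of "\<lambda>j. 3 - D1 j" "q - 1"])
        show "periodic n (\<lambda>j. 3 - D1 j)" using per[OF D1] by (simp add: periodic_def)
        show "0 \<le> 3 - D1 j" if "q - 1 \<le> j" "j < q - 1 + n" for j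
        proof -
          have "F j \<le> 1"
          proof (cases "j < p + n")
            case True
            then show ?thesis using F1[of j] that ord d9 by auto
          next
            case False
            then show ?thesis using F1[of "j - n"] periodic_minus[OF perF, of j] that ord d9 by auto
          qed
          then show ?thesis using D1w[OF that] hole' i ord by (auto simp: lhook_def rfront_def)
        qed
      qed
      then show ?thesis by simp
    qed
    \<comment> \<open>The reflected slack zero sits one or two places further on; these nonzero
      values keep it inside the stretch.\<close>
    have nz: "D1 (p + n - 2) \<noteq> 0" "D1 (p + n - 1) \<noteq> 0"
      using D1w[of "p + n - 2"] D1w[of "p + n - 1"] F0[of "p + n - 2"] F0[of "p + n - 1"] ord i
      by (auto simp: rfront_def lhook_def)
    obtain i' where i': "slack (\<lambda>j. D1 (- j)) i'" "i' = - i - 1 \<and> D1 (i + 1) = 0 \<or> i' = - i - 2 \<and> D1 (i + 2) = 0"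
      using slack_reflect[OF sl] by blast
    interpret R: positive_rank_class n d "(\<lambda>D i. D (- i)) ` C" by (rule reflect)
    show False
    proof (rule R.hook_dead[of "\<lambda>j. D1 (- j)" "\<lambda>j. F (- j)" "1 - p - n" "1 - q" i'])
      show "(\<lambda>j. D1 (- j)) = (\<lambda>j. F (- j) + hook (1 - p - n) (1 - q) j)"
      proof
        fix j
        have c: "chip (1 - p - n) = chip (1 - p)" "chip (2 - p - n) = chip (2 - p)"
          using chip_add_period[of "1 - p - n"] chip_add_period[of "2 - p - n"] by simp_all
        have e: "1 - p - n + 1 = 2 - p - n" by simp
        show "D1 (- j) = F (- j) + hook (1 - p - n) (1 - q) j"
          unfolding hook_def e c D1_def chip_uminus
          by (simp add: algebra_simps)
      qed
      show "1 - p - n + 2 \<le> i'" "i' + 4 \<le> 1 - q"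
        using i' i nz by (smt (verit))+
    qed (use D1 d9 flat1 F0 Fq i'(1) ord in \<open>auto simp: algebra_simps\<close>)
  qed
  have c1: "2 * (q - p - 5) \<le> 3 * (\<Sum>j\<in>{p + 2..q - 4}. F j) + 2 \<and> p + 2 \<le> q - 4 + 1 \<or> q - p \<le> 4"
  proof (cases "p + 2 \<le> q - 4 + 1")
    case True
    have "D (p + 2 - 1) \<noteq> 0" using pat[of "p + 2 - 1"] by (auto simp: lfront_def rhook_def split: if_splits)
    then have "2 * (q - 4 - (p + 2) + 1) \<le> 3 * (\<Sum>j\<in>{p + 2..q - 4}. D j) + 2"
      by (intro count_no_slack[OF True nonneg[OF D]] inner) (use True in auto)
    moreover have "(\<Sum>j\<in>{p + 2..q - 4}. D j) = (\<Sum>j\<in>{p + 2..q - 4}. F j)"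
      using hook_window[of p _ p q] ord by (intro sum.cong) (auto simp: F_def lfront_def rhook_def)
    ultimately show ?thesis using True by simp
  qed auto
  have c2: "2 * (p + n - q - 5) \<le> 3 * (\<Sum>j\<in>{q + 3..p + n - 3}. F j) + 2 \<and> q + 3 \<le> p + n - 3 + 1 \<or> p + n - q \<le> 4"
  proof (cases "q + 3 \<le> p + n - 3 + 1")
    case True
    have "D1 (q + 3 - 1) \<noteq> 0"
      using D1w[of "q + 3 - 1"] F0[of "q + 3 - 1"] ord True by (auto simp: lhook_def rfront_def)
    then have "2 * (p + n - 3 - (q + 3) + 1) \<le> 3 * (\<Sum>j\<in>{q + 3..p + n - 3}. D1 j) + 2"
      by (intro count_no_slack[OF True nonneg[OF D1]] outer) (use True in auto)
    moreover have "(\<Sum>j\<in>{q + 3..p + n - 3}. D1 j) = (\<Sum>j\<in>{q + 3..p + n - 3}. F j)"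
      using ord by (intro sum.cong) (auto simp: D1w lhook_def rfront_def)
    ultimately show ?thesis using True by simp
  qed auto
  have "(\<Sum>j\<in>{p + 2..q - 4} \<union> {q + 3..p + n - 3}. F j) \<le> d - 8"
    using ord by (intro Fs) auto
  then have "(\<Sum>j\<in>{p + 2..q - 4}. F j) + (\<Sum>j\<in>{q + 3..p + n - 3}. F j) \<le> d - 8"
    by (subst (asm) sum.union_disjoint) auto
  moreover have "0 \<le> (\<Sum>j\<in>{p + 2..q - 4}. F j)" "0 \<le> (\<Sum>j\<in>{q + 3..p + n - 3}. F j)"
    using F0 by (simp_all add: sum_nonneg)
  ultimately show False using c1 c2 d8 d9 large by (smt (verit))
qed

lemma no_left_hook:
  assumes D: "D \<in> C" and d9: "d \<le> 9" and flat: "\<And>j. D j \<le> 3"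
    and pat: "\<And>j. lhook p j + rfront q j \<le> D j" and hole: "D (p + 1) = 0"
    and ord: "p + 3 \<le> q" "q + 3 \<le> p + n" and large: "d = 8 \<Longrightarrow> 15 \<le> n" "d = 9 \<Longrightarrow> 16 \<le> n"
  shows False
proof -
  interpret R: positive_rank_class n d "(\<lambda>D i. D (- i)) ` C" by (rule reflect)
  have "lfront (- q) j + rhook (- p) j \<le> D (- j)" for j
    using pat[of "- j"] reflect_fronts(1)[of q "- j"] reflect_fronts(3)[of p "- j"] by simp
  then show False
    using R.no_right_hook[of "\<lambda>j. D (- j)" "- q" "- p"] D d9 flat hole ord large by (auto simp: add.commute)
qed

end

section \<open>Two pairs of fronts\<close>

context positive_rank_class begin

text \<open>Of the 10, four front vertices account for 8 and the ends of the discharged stretch for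
  2.\<close>

lemma state_count:
  assumes D: "D \<in> C" and St: "D = (\<lambda>j. E j + ends a b j)" and E0: "\<And>j. 0 \<le> E j"
    and ord: "a + 1 \<le> b" "b + 3 \<le> a + n"
    and ns: "\<And>i. a + 2 \<le> i \<Longrightarrow> i + 2 \<le> b \<Longrightarrow> \<not> slack D i"
  shows "2 * (b - a + 1) \<le> 10 + 3 * (\<Sum>j\<in>{a + 2..b - 2}. E j)"
proof (cases "a + 3 \<le> b")
  case True
  have win: "D j = E j + lfront a j + rfront b j" if "a \<le> j" "j < a + n" for j
    using ends_window[of a j a b] that ord by (simp add: St)
  have "D (a + 2 - 1) \<noteq> 0"
    using win[of "a + 2 - 1"] E0[of "a + 2 - 1"] ord by (auto simp: lfront_def rfront_def)
  then have "2 * (b - 2 - (a + 2) + 1) \<le> 3 * (\<Sum>j\<in>{a + 2..b - 2}. D j) + 2"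
    by (intro count_no_slack nonneg[OF D] ns) (use True in auto)
  moreover have "(\<Sum>j\<in>{a + 2..b - 2}. D j) = (\<Sum>j\<in>{a + 2..b - 2}. E j)"
    using ord by (intro sum.cong) (auto simp: win lfront_def rfront_def)
  ultimately show ?thesis by simp
next
  case False
  moreover have "0 \<le> (\<Sum>j\<in>{a + 2..b - 2}. E j)" using E0 by (simp add: sum_nonneg)
  ultimately show ?thesis by auto
qed

lemma state_periodic:
  assumes "D \<in> C" "D = (\<lambda>j. E j + ends a b j)"
  shows "periodic n E"
proof -
  have "E = (\<lambda>j. D j - ends a b j)" using assms(2) by simp
  then show ?thesis using per[OF assms(1)] ends_periodic by (simp add: periodic_def)
qed

lemma state_sum:
  assumes "D \<in> C" "D = (\<lambda>j. E j + ends a b j)" "\<And>j. 0 \<le> E j" "S \<subseteq> {w..<w + n}"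
  shows "(\<Sum>j\<in>S. E j) \<le> d - 6"
  using sum_remainder[OF assms(1), of E "ends a b" 6 S w, OF _ assms(3) ends_periodic ends_sum assms(4)] assms(2)
  by simp

text \<open>Hooks are excluded by the previous lemmas, pairs and triples by
  \<open>state_no_pair\<close>; what remains is \<open>state_interval\<close>. The work lies in
  showing that \<open>D\<close> is at most 3 everywhere, as \<open>legal_pattern\<close>
  demands.\<close>

lemma state_slack:
  assumes D: "D \<in> C" and d9: "d \<le> 9" and St: "D = (\<lambda>j. E j + ends a b j)" and E0: "\<And>j. 0 \<le> E j"
    and ord: "b + 3 \<le> a + n" and caps: "E a \<le> 1" "E b \<le> 1" "E (a - 1) \<le> 1" "E (b + 1) \<le> 1"
    and slack: "slack D i" and i: "a + 2 \<le> i" "i + 2 \<le> b"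
    and large: "d = 8 \<Longrightarrow> 15 \<le> n" "d = 9 \<Longrightarrow> 16 \<le> n"
  shows "right_room E b \<and> left_room E a \<or> (\<exists>p. i < p \<and> p < b \<and> 2 \<le> E p \<and> 1 \<le> E (p + 1))
    \<or> (\<exists>q. a < q \<and> q < i \<and> 2 \<le> E q \<and> 1 \<le> E (q - 1))"
proof -
  have perE: "periodic n E" by (rule state_periodic[OF D St])
  have Eper: "E (j + n) = E j" for j using perE by (simp add: periodic_def)
  have Es: "(\<Sum>j\<in>S. E j) \<le> 3" if "S \<subseteq> {w..<w + n}" for S w
    using state_sum[OF D St E0 that] d9 by simp
  have E2: "E x + E y \<le> 3" if "w \<le> x" "x < y" "y < w + n" for w x y
    using Es[of "{x, y}" w] that by simp
  have E3: "E x + E y + E z \<le> 3" if "w \<le> x" "x < y" "y < z" "z < w + n" for w x y z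
    using Es[of "{x, y, z}" w] that by simp
  have E4: "E x + E y + E z + E v \<le> 3" if "w \<le> x" "x < y" "y < z" "z < v" "v < w + n" for w x y z v
    using Es[of "{x, y, z, v}" w] that by simp
  have E1: "E x \<le> 3" for x using Es[of "{x}" x] n5 by simp
  have win: "D j = E j + lfront (a + n) j + rfront b j" if "i \<le> j" "j < i + n" for j
    using ends_window[of i j "a + n" b] that i ord by (simp add: St ends_add_period)
  define D1 where "D1 = (\<lambda>j. E j + ends (b + 1) (a - 1) j)"
  have D1: "D1 \<in> C" unfolding D1_def by (rule fire_block[OF D St E0]) (use i in auto)
  have D1w: "D1 j = E j + lfront (b + 1) j + rfront (a + n - 1) j"
    if "b - 1 \<le> w" "w \<le> b + 1" "w \<le> j" "j < w + n" for j w
  proof -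
    have "ends (b + 1) (a - 1) = ends (b + 1) (a + n - 1)"
      using ends_add_period(2)[of "b + 1" "a - 1"] by (simp add: algebra_simps)
    then show ?thesis
      using ends_window[of w j "b + 1" "a + n - 1"] that i ord by (simp add: D1_def)
  qed
  have flat1: "D1 j \<le> 3" if E: "\<And>x. x \<noteq> v \<Longrightarrow> w \<le> x \<Longrightarrow> x < w + n \<Longrightarrow> E x = 0"
    and w: "b - 1 \<le> w" "w \<le> b + 1" and v: "v < b + 1 \<or> a + n - 1 < v" for v w j
  proof -
    have "0 \<le> 3 - D1 j"
    proof (rule nonneg_if_window[of "\<lambda>j. 3 - D1 j" w])
      show "periodic n (\<lambda>j. 3 - D1 j)" using per[OF D1] by (simp add: periodic_def)
      show "0 \<le> 3 - D1 j" if "w \<le> j" "j < w + n" for j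
        using D1w[OF w that] E[of j] E1[of j] that v ord unfolding lfront_def rfront_def by (smt (verit))
    qed
    then show ?thesis by simp
  qed
  \<comment> \<open>Three free chips on \<open>b - 1\<close> would be all there are. After firing,
    they form a left hook with the new front on \<open>b + 1\<close>, \<open>b + 2\<close> and the
    empty vertex \<open>b\<close>.\<close>
  have b1: "E (b - 1) \<le> 2"
  proof (rule ccontr)
    assume "\<not> ?thesis"
    then have v: "E (b - 1) = 3" using E1[of "b - 1"] by simp
    have z: "E x = 0" if "x \<noteq> b - 1" "b - 1 \<le> x" "x < b - 1 + n" for x
      using E2[of "b - 1" "b - 1" x] E0[of x] v that by simp
    show False
    proof (rule no_left_hook[OF D1 d9, of "b - 1" "a + n - 1"])
      show "D1 j \<le> 3" for j using flat1[of "b - 1" "b - 1"] z by simp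
      show "lhook (b - 1) j + rfront (a + n - 1) j \<le> D1 j" for j
      proof (cases "b - 1 \<le> j \<and> j < b - 1 + n")
        case True
        then show ?thesis using D1w[of "b - 1" j] v E0[of j] by (auto simp: lhook_def lfront_def)
      next
        case False
        then show ?thesis using nonneg[OF D1, of j] i ord by (auto simp: lhook_def rfront_def)
      qed
      show "D1 (b - 1 + 1) = 0"
        using D1w[of "b - 1" b] z[of b] i ord by (auto simp: lfront_def rfront_def)
    qed (use i ord large in auto)
  qed
  have a1: "E (a + 1) \<le> 2"
  proof (rule ccontr)
    assume "\<not> ?thesis"
    then have v: "E (a + n + 1) = 3" using E1[of "a + 1"] Eper[of "a + 1"] by (simp add: algebra_simps)
    have z: "E x = 0" if "x \<noteq> a + n + 1" "b + 1 \<le> x" "x < b + 1 + n" for x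
      using E2[of "b + 1" "a + n + 1" x] E2[of "b + 1" x "a + n + 1"] E0[of x] v that i ord by (cases "x < a + n + 1") auto
    show False
    proof (rule no_right_hook[OF D1 d9, of "b + 1" "a + n + 1"])
      show "D1 j \<le> 3" for j using flat1[of "a + n + 1" "b + 1"] z by simp
      show "lfront (b + 1) j + rhook (a + n + 1) j \<le> D1 j" for j
      proof (cases "b + 1 \<le> j \<and> j < b + 1 + n")
        case True
        then show ?thesis using D1w[of "b + 1" j] v E0[of j] by (auto simp: rhook_def rfront_def)
      next
        case False
        then show ?thesis using nonneg[OF D1, of j] i ord by (auto simp: rhook_def lfront_def)
      qed
      show "D1 (a + n + 1 - 1) = 0"
        using D1w[of "b + 1" "a + n"] z[of "a + n"] i ord by (auto simp: lfront_def rfront_def)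
    qed (use i ord large in auto)
  qed
  have flat: "D j \<le> 3" for j
  proof -
    have "0 \<le> 3 - D j"
    proof (rule nonneg_if_window[of "\<lambda>j. 3 - D j" i])
      show "periodic n (\<lambda>j. 3 - D j)" using per[OF D] by (simp add: periodic_def)
      show "0 \<le> 3 - D j" if "i \<le> j" "j < i + n" for j
        using win[OF that] E1[of j] caps a1 b1 Eper[of a] Eper[of "a + 1"] ord i
        by (auto simp: lfront_def rfront_def algebra_simps)
    qed
    then show ?thesis by simp
  qed
  have ord': "i + 2 \<le> b" "b + 3 \<le> a + n" "a + n + 2 \<le> i + n" using i ord by auto
  have caps': "E (a + n) \<le> 1" "E b \<le> 1" "E (a + n - 1) \<le> 1" "E (b + 1) \<le> 1"
    using caps Eper[of a] Eper[of "a - 1"] by (simp_all add: algebra_simps)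
  show ?thesis
  proof (rule legal_pattern[OF D d9 flat slack])
    fix p q assume pq: "i + 2 \<le> p" "p < q" "q < i + n" "\<And>j. lfront p j + rfront q j \<le> D j"
    have room: "left_room E (a + n) = left_room E a"
      using Eper[of "a - 1"] Eper[of "a + 1"] Eper[of "a + 2"] by (simp add: left_room_def algebra_simps)
    have Eq: "E q = E (q - n)" "E (q - 1) = E (q - n - 1)"
      using Eper[of "q - n"] Eper[of "q - n - 1"] by simp_all
    consider "right_room E b \<and> left_room E (a + n)" | "p < b" "2 \<le> E p" "1 \<le> E (p + 1)"
      | "a + n < q" "2 \<le> E q" "1 \<le> E (q - 1)"
      using state_interval[of i n D E "a + n" b p q, OF win E0 E2[of i] E3[of i] E4[of i] ord' caps' pq] by blast
    then show ?thesis
    proof cases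
      case 1
      then show ?thesis using room by simp
    next
      case 2
      then show ?thesis using pq(1) by (intro disjI2 disjI1 exI[of _ p]) simp
    next
      case 3
      then show ?thesis using pq(3) Eq by (intro disjI2 exI[of _ "q - n"]) simp
    qed
  next
    fix p assume "i + 2 \<le> p" "p + 2 < i + n" "D p = 3" "D (p + 2) = 3" "D (p + 1) \<le> 1"
    then show ?thesis using state_no_pair[of i n D E "a + n" b p 2, OF win E0 E2[of i] E3[of i] ord'] by simp
  next
    fix p assume "i + 2 \<le> p" "p + 4 < i + n" "D p = 3" "2 \<le> D (p + 2)" "D (p + 4) = 3"
    then show ?thesis using state_no_pair[of i n D E "a + n" b p 4, OF win E0 E2[of i] E3[of i] ord'] by simp
  next
    fix p q assume "i + 2 \<le> p" "p + 3 \<le> q" "q < i + n" "D (q - 1) = 0" "\<And>j. lfront p j + rhook q j \<le> D j"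
    then show ?thesis using no_right_hook[OF D d9 flat, of p q] large by auto
  next
    fix p q assume "i + 2 \<le> p" "p + 3 \<le> q" "q < i + n" "D (p + 1) = 0" "\<And>j. lhook p j + rfront q j \<le> D j"
    then show ?thesis using no_left_hook[OF D d9 flat, of p q] large by auto
  qed
qed

end

section \<open>States: a legal arc together with its free chips\<close>

context positive_rank_class begin

text \<open>\<open>E\<close> collects the chips that stay in place when the arc from \<open>a\<close> to \<open>b\<close> is fired.\<close>

definition state :: "(int \<Rightarrow> int) \<Rightarrow> int \<Rightarrow> int \<Rightarrow> (int \<Rightarrow> int) \<Rightarrow> bool" where
  "state D a b E \<longleftrightarrow> D \<in> C \<and> D = (\<lambda>j. E j + ends a b j) \<and> (\<forall>j. 0 \<le> E j) \<and> a + 1 \<le> b \<and> b + 3 \<le> a + n"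

text \<open>These are the vertices that receive two front chips before or after the arc is fired, so
  firing preserves the condition.\<close>

definition capped :: "int \<Rightarrow> int \<Rightarrow> (int \<Rightarrow> int) \<Rightarrow> bool" where
  "capped a b E \<longleftrightarrow> E a \<le> 1 \<and> E b \<le> 1 \<and> E (a - 1) \<le> 1 \<and> E (b + 1) \<le> 1"

lemma state_fire:
  assumes "state D a b E"
  shows "state (\<lambda>j. E j + ends (b + 1) (a - 1 + n) j) (b + 1) (a - 1 + n) E"
proof -
  have "ends (b + 1) (a - 1 + n) = ends (b + 1) (a - 1)" by (rule ends_add_period(2))
  then show ?thesis using assms fire_block[of D E a b] by (auto simp: state_def)
qed

lemma state_arc_count:
  assumes St: "state D a b E" and caps: "capped a b E" and d9: "d \<le> 9"
    and large: "d = 8 \<Longrightarrow> 15 \<le> n" "d = 9 \<Longrightarrow> 16 \<le> n"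
    and room: "\<not> (right_room E b \<and> left_room E a)"
    and pile: "\<And>i p. a + 2 \<le> i \<Longrightarrow> i < p \<Longrightarrow> p < b \<Longrightarrow> 2 \<le> E p \<Longrightarrow> 1 \<le> E (p + 1) \<Longrightarrow> False"
      "\<And>i q. a < q \<Longrightarrow> q < i \<Longrightarrow> i + 2 \<le> b \<Longrightarrow> 2 \<le> E q \<Longrightarrow> 1 \<le> E (q - 1) \<Longrightarrow> False"
  shows "2 * (b - a + 1) \<le> 10 + 3 * (\<Sum>j\<in>{a + 2..b - 2}. E j)"
proof (rule state_count)
  show "D \<in> C" "D = (\<lambda>j. E j + ends a b j)" "0 \<le> E j" "a + 1 \<le> b" "b + 3 \<le> a + n" for j
    using St by (auto simp: state_def)
  show "\<not> slack D i" if "a + 2 \<le> i" "i + 2 \<le> b" for i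
  proof
    assume "slack D i"
    then show False
      using state_slack[of D E a b i] St caps d9 large room pile that unfolding state_def capped_def by blast
  qed
qed

lemma quiet_arc:
  assumes "state D a b E" "capped a b E" "d \<le> 9" "d = 8 \<Longrightarrow> 15 \<le> n" "d = 9 \<Longrightarrow> 16 \<le> n"
    and "\<not> right_room E b" and quiet: "\<And>j. a < j \<Longrightarrow> j < b \<Longrightarrow> E j = 0"
  shows "b - a + 1 \<le> 5"
proof -
  have "(\<Sum>j\<in>{a + 2..b - 2}. E j) = 0" using quiet by simp
  moreover have "2 * (b - a + 1) \<le> 10 + 3 * (\<Sum>j\<in>{a + 2..b - 2}. E j)"
    by (rule state_arc_count[OF assms(1-5)]) (use assms(6) quiet in force)+
  ultimately show ?thesis by simp
qed

text \<open>The pile uses all free chips, so \<open>d = 9\<close>, and it is itself a left front at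
  \<open>p\<close>. The cycle splits at three fronts into three arcs. Each becomes, after suitable
  firing, an arc without inner free chips and has at most 5 vertices, contradicting
  \<open>16 \<le> n\<close>.\<close>

lemma no_pile:
  assumes St: "state D a b E" and d9: "d \<le> 9" and large: "d = 8 \<Longrightarrow> 15 \<le> n" "d = 9 \<Longrightarrow> 16 \<le> n"
    and p: "a + 3 \<le> p" "p < b" "2 \<le> E p" "1 \<le> E (p + 1)"
  shows False
proof -
  have D: "D \<in> C" "D = (\<lambda>j. E j + ends a b j)" and E0: "\<And>j. 0 \<le> E j" and ord: "a + 1 \<le> b" "b + 3 \<le> a + n"
    using St by (auto simp: state_def)
  have Es: "(\<Sum>j\<in>S. E j) \<le> d - 6" if "S \<subseteq> {p..<p + n}" for S
    by (rule state_sum[OF D E0 that])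
  have "E p + E (p + 1) \<le> d - 6" using Es[of "{p, p + 1}"] n5 by simp
  then have v: "d = 9" "E p = 2" "E (p + 1) = 1" using p d9 by auto
  have z: "E j = 0" if "p + 1 < j" "j < p + n" for j
    using Es[of "{p, p + 1, j}"] v E0[of j] that by simp
  define F where "F = (\<lambda>j. E j - 2 * chip p j - chip (p + 1) j)"
  have perF: "periodic n F"
    using state_periodic[OF D] chip_periodic by (simp add: F_def periodic_def)
  have "F j = 0" if "p \<le> j" "j < p + n" for j
    using that v z[of j] chip_near[of j p] chip_near[of j "p + 1"] n5
    by (cases "j = p \<or> j = p + 1") (auto simp: F_def)
  then have "0 \<le> F j" "0 \<le> - F j" for j
    using nonneg_if_window[of F p] nonneg_if_window[of "\<lambda>j. - F j" p] perF by (auto simp: periodic_def)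
  then have "E j = 2 * chip p j + chip (p + 1) j" for j
    unfolding F_def by (smt (verit))
  then have E: "E = (\<lambda>j. 2 * chip p j + chip (p + 1) j)" by blast
  have chips: "chip c j = of_bool (j = c)" if "j - c < n" "c - j < n" for c j
    using chip_near that .
  have chip_le: "chip c j \<le> 1" for c j by (simp add: chip_def)
  have 1: "a - 1 + n - (b + 1) + 1 \<le> 5"
  proof (rule quiet_arc[OF state_fire[OF St] _ d9 large])
    show "capped (b + 1) (a - 1 + n) E" "\<not> right_room E (a - 1 + n)"
      using p ord by (auto simp: E capped_def right_room_def chips)
    show "E j = 0" if "b + 1 < j" "j < a - 1 + n" for j
      using p ord that by (auto simp: E chips)
  qed
  \<comment> \<open>The pile now serves as the left front of the arc from \<open>p\<close> to
    \<open>b\<close>, and the old front at \<open>a\<close> counts as free.\<close>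
  define E1 where "E1 = (\<lambda>j. 2 * chip a j + chip (a + 1) j)"
  have St1: "state D p b E1"
    using D p ord by (auto simp: state_def E1_def E ends_def)
  have 2: "b - p + 1 \<le> 5"
  proof (rule quiet_arc[OF St1 _ d9 large])
    show "capped p b E1" "\<not> right_room E1 b"
      using p ord by (auto simp: E1_def capped_def right_room_def chips)
    show "E1 j = 0" if "p < j" "j < b" for j
      using p ord that by (auto simp: E1_def chips)
  qed
  \<comment> \<open>After firing that arc, the front at \<open>a\<close> is matched with the new
    right front at \<open>p - 1\<close>, and the new front at \<open>b + 1\<close> is free.\<close>
  define E2 where "E2 = (\<lambda>j. 2 * chip (b + 1) j + chip (b + 2) j)"
  have "(\<lambda>j. E1 j + ends (b + 1) (p - 1) j) \<in> C"
    by (rule fire_block[of D]) (use St1 in \<open>auto simp: state_def\<close>)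
  moreover have "(\<lambda>j. E1 j + ends (b + 1) (p - 1) j) = (\<lambda>j. E2 j + ends a (p - 1) j)"
    by (simp add: E1_def E2_def ends_def fun_eq_iff algebra_simps)
  ultimately have St2: "state (\<lambda>j. E2 j + ends a (p - 1) j) a (p - 1) E2"
    using p ord by (auto simp: state_def E2_def)
  have 3: "p - 1 - a + 1 \<le> 5"
  proof (rule quiet_arc[OF St2 _ d9 large])
    show "capped a (p - 1) E2" "\<not> right_room E2 (p - 1)"
      using p ord chip_le[of "b + 2" "a - 1"] by (auto simp: E2_def capped_def right_room_def chips)
    show "E2 j = 0" if "a < j" "j < p - 1" for j
      using p ord that by (auto simp: E2_def chips)
  qed
  show False using large(2) v(1) 1 2 3 by simp
qed

lemma no_pile_left:
  assumes St: "state D a b E" and d9: "d \<le> 9" and large: "d = 8 \<Longrightarrow> 15 \<le> n" "d = 9 \<Longrightarrow> 16 \<le> n"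
    and q: "a < q" "q + 3 \<le> b" "2 \<le> E q" "1 \<le> E (q - 1)"
  shows False
proof -
  interpret R: positive_rank_class n d "(\<lambda>D i. D (- i)) ` C" by (rule reflect)
  have neg: "ends a b (- j) = ends (- b) (- a) j" for j
    by (simp add: ends_def chip_uminus)
  have "(\<lambda>j. D (- j)) \<in> (\<lambda>D i. D (- i)) ` C"
    by (rule rev_image_eqI[OF conjunct1[OF St[unfolded state_def]]]) simp
  moreover have "(\<lambda>j. D (- j)) = (\<lambda>j. E (- j) + ends (- b) (- a) j)"
    using St unfolding state_def fun_eq_iff neg[symmetric] by simp
  ultimately have "R.state (\<lambda>j. D (- j)) (- b) (- a) (\<lambda>j. E (- j))"
    using St by (simp only: R.state_def state_def) auto
  then show False
    by (rule R.no_pile[OF _ d9 large, of _ _ _ _ "- q"]) (use q in auto)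
qed

lemma state_count_room:
  assumes St: "state D a b E" and caps: "capped a b E" and d9: "d \<le> 9"
    and large: "d = 8 \<Longrightarrow> 15 \<le> n" "d = 9 \<Longrightarrow> 16 \<le> n"
    and room: "\<not> (a + 4 \<le> b \<and> right_room E b \<and> left_room E a)"
  shows "2 * (b - a + 1) \<le> 10 + 3 * (\<Sum>j\<in>{a + 2..b - 2}. E j)"
proof (cases "a + 4 \<le> b")
  case True
  then show ?thesis
    by (intro state_arc_count[OF St caps d9 large])
      (use room no_pile[OF St d9 large] no_pile_left[OF St d9 large] in force)+
next
  case False
  have "0 \<le> (\<Sum>j\<in>{a + 2..b - 2}. E j)" using St by (intro sum_nonneg) (simp add: state_def)
  then show ?thesis using False by simp
qed

end

section \<open>Two legal arcs at once, and the final count\<close>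

context positive_rank_class begin

text \<open>Room on both sides lets \<open>D\<close> be read as a second state, whose arc runs from
  \<open>p\<close> around the cycle to \<open>q + n\<close>. Firing one arc or the other prepares
  the complements \<open>{b + 1..a - 1 + n}\<close> and \<open>{q + 1..p - 1}\<close>. The chips
  that gave room keep both complements from having room on both sides, so both are short; the two
  overlaps of the arcs are at most \<open>k + 1\<close> and \<open>k' + 1\<close> long.\<close>

lemma advance:
  assumes St: "state D a b E" and caps: "capped a b E" and d9: "d \<le> 9"
    and large: "d = 8 \<Longrightarrow> 15 \<le> n" "d = 9 \<Longrightarrow> 16 \<le> n"
    and slack: "slack D i" and i: "a + 2 \<le> i" "i + 2 \<le> b"
    and room: "right_room E b" "left_room E a"
  shows False
proof -
  have D: "D \<in> C" "D = (\<lambda>j. E j + ends a b j)" and E0: "\<And>j. 0 \<le> E j" and ord: "a + 1 \<le> b" "b + 3 \<le> a + n"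
    using St by (auto simp: state_def)
  have win: "D j = E j + lfront a j + rfront b j" if "a \<le> j" "j < a + n" for j
    using ends_window[of a j a b] that ord D(2) by (simp add: D(2))
  have Di: "D i = 0" "D (i + 1) = 0 \<or> D (i + 1) = 1 \<and> D (i + 2) = 0"
    using slack by (auto simp: slack_def)
  have vals: "D i = E i + lfront a i + rfront b i" "D (i + 1) = E (i + 1) + lfront a (i + 1) + rfront b (i + 1)"
    "D (i + 2) = E (i + 2) + lfront a (i + 2) + rfront b (i + 2)"
    using i ord by (intro win; simp)+
  have Ei: "E i = 0" "i + 3 \<le> b"
    using Di vals i ord E0[of i] E0[of "i + 1"] E0[of "i + 2"] unfolding lfront_def rfront_def by (smt (verit))+
  have Ei1: "i + 3 = b \<Longrightarrow> E (i + 1) = 0"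
    using Di vals i ord E0[of i] E0[of "i + 1"] E0[of "i + 2"] unfolding lfront_def rfront_def by (smt (verit))
  \<comment> \<open>Turning the right front around binds \<open>k\<close> free chips on
    \<open>v\<close> and releases \<open>k\<close> front chips on \<open>u\<close>;
    \<open>split_r\<close> is the exact balance. In the case \<open>p = b\<close>, the condition
    \<open>E (b - 1) = 0\<close> is needed for the cap at \<open>p - 1 = u\<close>.\<close>
  obtain p u v k where R: "p = b - 1 \<and> u = b \<and> v = b - 1 \<and> k = 1
      \<or> p = b \<and> u = b - 1 \<and> v = b + 1 \<and> k = 1 \<and> E (b - 1) = 0 \<or> p = b - 2 \<and> u = b \<and> v = b - 2 \<and> k = 2"
    and kv: "k \<le> E v" and ip: "i + 2 \<le> p"
  proof (cases "1 \<le> E (b - 1)")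
    case True
    then show thesis using that[of "b - 1" b "b - 1" 1] Ei by simp
  next
    case nb: False
    show thesis
    proof (cases "1 \<le> E (b + 1)")
      case True
      then show thesis using that[of b "b - 1" "b + 1" 1] Ei nb E0[of "b - 1"] by simp
    next
      case False
      then have "2 \<le> E (b - 2)" using room nb by (simp add: right_room_def)
      moreover have "i + 3 \<noteq> b" using calculation Ei1 by (auto simp: algebra_simps)
      ultimately show thesis using that[of "b - 2" b "b - 2" 2] Ei by simp
    qed
  qed
  obtain q u' v' k' where L: "q = a + 1 \<and> u' = a \<and> v' = a + 1 \<and> k' = 1
      \<or> q = a \<and> u' = a + 1 \<and> v' = a - 1 \<and> k' = 1 \<and> E (a + 1) = 0 \<or> q = a + 2 \<and> u' = a \<and> v' = a + 2 \<and> k' = 2"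
    and kv': "k' \<le> E v'" and qi: "q < i"
  proof (cases "1 \<le> E (a + 1)")
    case True
    then show thesis using that[of "a + 1" a "a + 1" 1] i by simp
  next
    case na: False
    show thesis
    proof (cases "1 \<le> E (a - 1)")
      case True
      then show thesis using that[of a "a + 1" "a - 1" 1] i na E0[of "a + 1"] by simp
    next
      case False
      then have "2 \<le> E (a + 2)" using room na by (simp add: left_room_def)
      moreover have "i \<noteq> a + 2" using calculation Ei by auto
      ultimately show thesis using that[of "a + 2" a "a + 2" 2] i by simp
    qed
  qed
  define F where "F = (\<lambda>j. E j + k * chip u j - k * chip v j + k' * chip u' j - k' * chip v' j)"
  have far: "a + 5 \<le> b" "a \<le> q" "q + 3 \<le> p" "p \<le> b" using ip qi i Ei R L by auto
  have kk: "1 \<le> k" "1 \<le> k'" "k \<le> 2" "k' \<le> 2" using R L by auto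
  have uv: "b - 1 \<le> u" "u \<le> b" "b - 2 \<le> v" "v \<le> b + 1" "a \<le> u'" "u' \<le> a + 1" "a - 1 \<le> v'" "v' \<le> a + 2"
    using R L by auto
  have vne: "v \<noteq> b" "v' \<noteq> a" using R L by auto
  have pq: "p - 1 \<le> u" "p \<le> v" "u' \<le> q + 1" "v' \<le> q" using R L by auto
  have Fwin: "F j = E j + k * of_bool (j = u) - k * of_bool (j = v) + k' * of_bool (j = u') - k' * of_bool (j = v')"
    if "a - 1 \<le> j" "j < a - 1 + n" for j
    using chip_near[of j u] chip_near[of j v] chip_near[of j u'] chip_near[of j v'] that uv ord
    by (simp add: F_def)
  have perE: "periodic n E" by (rule state_periodic[OF D])
  have perF: "periodic n F" using perE chip_periodic by (simp add: F_def periodic_def)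
  have F0: "0 \<le> F j" for j
  proof (rule nonneg_if_window[OF perF, of "a - 1"])
    fix j assume j: "a - 1 \<le> j" "j < a - 1 + n"
    show "0 \<le> F j"
      using Fwin[OF j] E0[of j] kv kv' kk uv far by (cases "j = v"; cases "j = v'") auto
  qed
  have split_r: "2 * chip b j + chip (b - 1) j = 2 * chip p j + chip (p + 1) j + k * chip u j - k * chip v j" for j
    using R by (auto simp: algebra_simps)
  have split_l: "2 * chip a j + chip (a + 1) j = 2 * chip q j + chip (q - 1) j + k' * chip u' j - k' * chip v' j" for j
    using L by (auto simp: algebra_simps)
  have DF: "D = (\<lambda>j. F j + ends p (q + n) j)"
  proof
    fix j
    have "ends p (q + n) j = ends p q j" using ends_add_period(2)[of p q] by simp
    then show "D j = F j + ends p (q + n) j"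
      using split_r[of j] split_l[of j] by (simp add: D(2) F_def ends_def)
  qed
  have StX: "state D p (q + n) F"
    using D(1) DF F0 far ord unfolding state_def by auto
  define D2 where "D2 = (\<lambda>j. F j + ends (q + n + 1) (p - 1 + n) j)"
  have "ends (q + n + 1) (p - 1 + n) = ends (q + 1) (p - 1)"
    using ends_add_period(1)[of "q + 1"] ends_add_period(2)[of "q + 1" "p - 1"] by (simp add: algebra_simps)
  then have StG: "state D2 (q + 1) (p - 1) F"
    using state_fire[OF StX] far ord unfolding D2_def state_def by simp
  have Fs: "(\<Sum>j\<in>S. F j) \<le> d - 6" if "S \<subseteq> {a..<a + n}" for S
    by (rule state_sum[OF D(1) DF F0 that])
  have Es: "(\<Sum>j\<in>S. E j) \<le> d - 6" if "S \<subseteq> {a - 1..<a - 1 + n}" for S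
    by (rule state_sum[OF D E0 that])
  have Fu: "k \<le> F u" "k' \<le> F u'"
    using Fwin[of u] Fwin[of u'] E0[of u] E0[of u'] R L far ord by auto
  have F3: "F x + F u + F u' \<le> 3" if "a \<le> x" "x \<le> b + 1" "x \<noteq> u" "x \<noteq> u'" for x
    using Fs[of "{x, u, u'}"] that uv far ord d9 by simp
  have F4: "F x + F y + F u + F u' \<le> 3"
    if "a \<le> x" "x \<le> b + 1" "x \<noteq> u" "x \<noteq> u'" "a \<le> y" "y \<le> b + 1" "y \<noteq> u" "y \<noteq> u'" "x \<noteq> y" for x y
    using Fs[of "{x, y, u, u'}"] that uv far ord d9 by simp
  have cap: "F x \<le> 1" if "a \<le> x" "x \<le> b + 1" "x = u \<Longrightarrow> E u = 0 \<and> k = 1" "x = u' \<Longrightarrow> E u' = 0 \<and> k' = 1" for x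
  proof (cases "x = u \<or> x = u'")
    case True
    then show ?thesis using Fwin[of x] that kk uv far ord by auto
  next
    case False
    then show ?thesis using F3[OF that(1,2)] Fu kk by simp
  qed
  have "F (q + 1) \<le> 1" "F (p - 1) \<le> 1" "F q \<le> 1" "F p \<le> 1"
    by (rule cap; use R L far in force)+
  then have capsG: "capped (q + 1) (p - 1) F" by (simp add: capped_def)
  \<comment> \<open>At least two of the at most three free chips lie on \<open>u\<close> and
    \<open>u'\<close>, where they provide no room. The rest cannot serve both ends.\<close>
  have 1: "2 * (p - 1 - (q + 1) + 1) \<le> 10 + 3 * (\<Sum>j\<in>{q + 1 + 2..p - 1 - 2}. F j)"
  proof (rule state_count_room[OF StG capsG d9 large])
    show "\<not> (q + 1 + 4 \<le> p - 1 \<and> right_room F (p - 1) \<and> left_room F (q + 1))"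
    proof
      assume *: "q + 1 + 4 \<le> p - 1 \<and> right_room F (p - 1) \<and> left_room F (q + 1)"
      obtain r where r0: "(r = p \<or> r = p - 2) \<and> 1 \<le> F r \<or> r = p - 3 \<and> 2 \<le> F r"
        using * by (auto simp: right_room_def)
      then have r: "r = p \<or> r = p - 2 \<or> r = p - 3 \<and> 2 \<le> F r" "1 \<le> F r" by auto
      obtain l where l0: "(l = q \<or> l = q + 2) \<and> 1 \<le> F l \<or> l = q + 3 \<and> 2 \<le> F l"
        using * by (auto simp: left_room_def algebra_simps)
      then have l: "l = q \<or> l = q + 2 \<or> l = q + 3 \<and> 2 \<le> F l" "1 \<le> F l" by auto
      have ru: "a \<le> r" "r \<le> b + 1" "r \<noteq> u" "r \<noteq> u'" using r(1) R L far * by auto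
      have lu: "a \<le> l" "l \<le> b + 1" "l \<noteq> u" "l \<noteq> u'" using l(1) R L far * by auto
      have "r = l \<Longrightarrow> 2 \<le> F r" using r(1) l(1) * by auto
      then show False using F3[OF ru] F4[OF ru lu] r(2) l(2) Fu kk by (cases "r = l") auto
    qed
  qed
  \<comment> \<open>The same holds for the outer arc, with the chips on \<open>v\<close> and
    \<open>v'\<close> tied up.\<close>
  have 2: "2 * (a - 1 + n - (b + 1) + 1) \<le> 10 + 3 * (\<Sum>j\<in>{b + 1 + 2..a - 1 + n - 2}. E j)"
  proof (rule state_count_room[OF state_fire[OF St] _ d9 large])
    have Eper: "E (j + n) = E j" for j using perE by (simp add: periodic_def)
    show "capped (b + 1) (a - 1 + n) E"
      using caps Eper[of a] Eper[of "a - 1"] by (simp add: capped_def algebra_simps)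
    show "\<not> (b + 1 + 4 \<le> a - 1 + n \<and> right_room E (a - 1 + n) \<and> left_room E (b + 1))"
    proof
      assume *: "b + 1 + 4 \<le> a - 1 + n \<and> right_room E (a - 1 + n) \<and> left_room E (b + 1)"
      have idx: "a - 1 + n + 1 = a + n" "a - 1 + n - 1 = a - 2 + n" "a - 1 + n - 2 = a - 3 + n" by simp_all
      obtain r where r0: "(r = a \<or> r = a - 2 + n) \<and> 1 \<le> E r \<or> r = a - 3 + n \<and> 2 \<le> E r"
        using * unfolding right_room_def idx Eper[of a] by blast
      then have r: "r = a \<or> r = a - 2 + n \<or> r = a - 3 + n \<and> 2 \<le> E r" "1 \<le> E r" by auto
      obtain l where l0: "(l = b \<or> l = b + 2) \<and> 1 \<le> E l \<or> l = b + 3 \<and> 2 \<le> E l"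
        using * by (auto simp: left_room_def algebra_simps)
      then have l: "l = b \<or> l = b + 2 \<or> l = b + 3 \<and> 2 \<le> E l" "1 \<le> E l" by auto
      have rv: "a - 1 \<le> r" "r < a - 1 + n" "r \<noteq> v" "r \<noteq> v'" using r(1) uv vne far * by auto
      have lv: "a - 1 \<le> l" "l < a - 1 + n" "l \<noteq> v" "l \<noteq> v'" using l(1) uv vne far * by auto
      have "r = l \<Longrightarrow> 2 \<le> E r" using r(1) l(1) far * by auto
      moreover have "E r + E v + E v' \<le> 3"
        using Es[of "{r, v, v'}"] rv uv far ord d9 by simp
      moreover have "r \<noteq> l \<Longrightarrow> E r + E l + E v + E v' \<le> 3"
        using Es[of "{r, l, v, v'}"] rv lv uv far ord d9 by simp
      ultimately show False using r(2) l(2) kv kv' kk by (cases "r = l") auto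
    qed
  qed
  have FE: "(\<Sum>j\<in>{q + 1 + 2..p - 1 - 2}. F j) = (\<Sum>j\<in>{q + 1 + 2..p - 1 - 2}. E j)"
  proof (rule sum.cong)
    fix j assume "j \<in> {q + 1 + 2..p - 1 - 2}"
    then show "F j = E j" using Fwin[of j] uv pq far ord by auto
  qed simp
  let ?G = "{q + 1 + 2..p - 1 - 2}" and ?W = "{b + 1 + 2..a - 1 + n - 2}"
  have "(\<Sum>j\<in>?G \<union> ?W \<union> {v, v'}. E j) \<le> d - 6"
    by (rule Es) (use uv pq far ord in auto)
  moreover have "(\<Sum>j\<in>?G \<union> ?W \<union> {v, v'}. E j) = (\<Sum>j\<in>?G. E j) + (\<Sum>j\<in>?W. E j) + (\<Sum>j\<in>{v, v'}. E j)"
  proof -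
    have "?G \<inter> ?W = {}" "(?G \<union> ?W) \<inter> {v, v'} = {}" using uv vne pq far ord by auto
    then show ?thesis by (simp only: sum.union_disjoint finite_Un finite_atLeastAtMost_int finite.intros simp_thms)
  qed
  moreover have "(\<Sum>j\<in>{v, v'}. E j) = E v + E v'" using uv far by simp
  ultimately have sum: "(\<Sum>j\<in>?G. E j) + (\<Sum>j\<in>?W. E j) \<le> d - 6 - k - k'" using kv kv' by simp
  have len: "b - p \<le> k" "q - a \<le> k'" using R L by auto
  have "n = (p - 1 - (q + 1) + 1) + (a - 1 + n - (b + 1) + 1) + (q - a + 1) + (b - p + 1)" by simp
  \<comment> \<open>Since \<open>k + k' \<ge> 2\<close>, the right-hand side is at most
    \<open>22 + 3 * (d - 6)\<close>.\<close>
  then have "2 * n \<le> 20 + 3 * (d - 6 - k - k') + 2 * (k + k' + 2)"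
    using 1 2 sum len unfolding FE by (simp add: algebra_simps)
  moreover have "0 \<le> d - 6 - k - k'"
    using sum sum_nonneg[of ?G E] sum_nonneg[of ?W E] E0 by (smt (verit))
  ultimately show False using large kk d9 by (cases "d = 8"; cases "d = 9") auto
qed

text \<open>By \<open>advance\<close>, an arc containing slack has no room on at least one side, so
  every capped state satisfies the length bound. Apply it to the arc and to the complement after
  firing, and add.\<close>

lemma state_impossible:
  assumes St: "state D a b E" and caps: "capped a b E" and d9: "d \<le> 9"
    and large: "d = 6 \<Longrightarrow> 11 \<le> n" "d = 7 \<Longrightarrow> 12 \<le> n" "d = 8 \<Longrightarrow> 15 \<le> n" "d = 9 \<Longrightarrow> 16 \<le> n"
  shows False
proof -
  have arc: "2 * (b - a + 1) \<le> 10 + 3 * (\<Sum>j\<in>{a + 2..b - 2}. E j)" if St: "state D a b E" and caps: "capped a b E" for D a b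
  proof (cases "\<exists>i. a + 2 \<le> i \<and> i + 2 \<le> b \<and> slack D i")
    case True
    then have "\<not> (right_room E b \<and> left_room E a)"
      using advance[OF St caps d9 large(3,4)] by blast
    then show ?thesis by (intro state_count_room[OF St caps d9 large(3,4)]) auto
  next
    case False
    then show ?thesis using St by (intro state_count[of D]) (auto simp: state_def)
  qed
  have D: "D \<in> C" "D = (\<lambda>j. E j + ends a b j)" and E0: "\<And>j. 0 \<le> E j" and ord: "a + 1 \<le> b" "b + 3 \<le> a + n"
    using St by (auto simp: state_def)
  have Eper: "E (j + n) = E j" for j using state_periodic[OF D] by (simp add: periodic_def)
  have caps': "capped (b + 1) (a - 1 + n) E"
    using caps Eper[of a] Eper[of "a - 1"] by (simp add: capped_def algebra_simps)
  let ?U = "{a + 2..b - 2}" and ?W = "{b + 1 + 2..a - 1 + n - 2}"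
  have "(\<Sum>j\<in>?U \<union> ?W. E j) \<le> d - 6"
    by (rule state_sum[OF D E0, where w = a]) (use ord in auto)
  moreover have "?U \<inter> ?W = {}" by auto
  ultimately have sum: "(\<Sum>j\<in>?U. E j) + (\<Sum>j\<in>?W. E j) \<le> d - 6"
    by (simp add: sum.union_disjoint)
  moreover define x y where "x = (\<Sum>j\<in>?U. E j)" and "y = (\<Sum>j\<in>?W. E j)"
  ultimately have "2 * n \<le> 20 + 3 * (d - 6)"
    using arc[OF St caps] arc[OF state_fire[OF St] caps'] unfolding x_def[symmetric] y_def[symmetric] by (simp add: algebra_simps)
  moreover have "6 \<le> d" using sum sum_nonneg[of ?U E] sum_nonneg[of ?W E] E0 by (smt (verit))
  ultimately show False using large d9 by (cases "d = 6"; cases "d = 7"; cases "d = 8"; cases "d = 9") auto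
qed

end

section \<open>The lower bound\<close>

context positive_rank_class begin

text \<open>The sum is the change of the sum of squares caused by firing \<open>f\<close>,
  restricted to a set containing the support of \<open>lap f\<close> in the window.\<close>

lemma square_sum_change:
  assumes D: "D \<in> C" and min: "\<And>D'. D' \<in> C \<Longrightarrow> (\<Sum>j\<in>{0..<n}. D j * D j) \<le> (\<Sum>j\<in>{0..<n}. D' j * D' j)"
    and f: "periodic n f" "\<And>j. w \<le> j \<Longrightarrow> j < w + n \<Longrightarrow> lap f j \<le> D j"
    and S: "S \<subseteq> {w..<w + n}" "\<And>j. w \<le> j \<Longrightarrow> j < w + n \<Longrightarrow> j \<notin> S \<Longrightarrow> lap f j = 0"
  shows "0 \<le> (\<Sum>j\<in>S. lap f j * lap f j - 2 * D j * lap f j)"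
proof -
  note perl = lap_periodic[OF f(1)]
  have "0 \<le> D j - lap f j" for j
    by (rule nonneg_if_window[of _ w]) (use perl per[OF D] f(2) in \<open>auto simp: periodic_def\<close>)
  then have "(\<lambda>j. D j - lap f j) \<in> C" by (intro fire[OF D f(1)]) simp
  then have "0 \<le> (\<Sum>j\<in>{0..<n}. (D j - lap f j) * (D j - lap f j)) - (\<Sum>j\<in>{0..<n}. D j * D j)"
    using min by fastforce
  also have "\<dots> = (\<Sum>j\<in>{0..<n}. lap f j * lap f j - 2 * D j * lap f j)"
    unfolding sum_subtractf[symmetric] by (rule sum.cong) (simp_all add: algebra_simps)
  also have "\<dots> = (\<Sum>j\<in>{w..<w + n}. lap f j * lap f j - 2 * D j * lap f j)"
    using perl per[OF D] by (intro sum_window_class[symmetric]) (simp add: periodic_def)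
  also have "\<dots> = (\<Sum>j\<in>S. lap f j * lap f j - 2 * D j * lap f j)"
    using S by (intro sum.mono_neutral_right) auto
  finally show ?thesis .
qed

text \<open>Firing a vertex with at least 4 chips changes the sum of squares by at most
  \<open>20 - 8 * D v + 2 * (9 - D v)\<close>, which is negative.\<close>

lemma minimal_flat:
  assumes D: "D \<in> C" and min: "\<And>D'. D' \<in> C \<Longrightarrow> (\<Sum>j\<in>{0..<n}. D j * D j) \<le> (\<Sum>j\<in>{0..<n}. D' j * D' j)"
    and d9: "d \<le> 9"
  shows "D v \<le> 3"
proof (rule ccontr)
  assume v: "\<not> ?thesis"
  let ?S = "{v - 2, v - 1, v, v + 1, v + 2}"
  have lap: "lap (chip v) j = 4 * of_bool (j = v) - of_bool (j = v - 1) - of_bool (j = v + 1) - of_bool (j = v - 2) - of_bool (j = v + 2)"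
    if "v - 2 \<le> j" "j < v - 2 + n" for j
    using that n5 by (simp add: lap_chip chip_near)
  have "0 \<le> (\<Sum>j\<in>?S. lap (chip v) j * lap (chip v) j - 2 * D j * lap (chip v) j)"
  proof (rule square_sum_change[OF D min chip_periodic, of "v - 2"])
    show "lap (chip v) j \<le> D j" if "v - 2 \<le> j" "j < v - 2 + n" for j
      using lap[OF that] nonneg[OF D, of j] v by (cases "j = v") auto
  qed (use n5 lap in auto)
  moreover have "(\<Sum>j\<in>?S. D j) \<le> d" by (rule sum_le_degree[OF D, of _ "v - 2"]) (use n5 in auto)
  ultimately show False using v d9 n5 by (simp add: lap)
qed

text \<open>Firing both vertices changes the sum of squares by at most
  \<open>26 - 36 + 2 * (3 + 1) = - 2\<close>.\<close>

lemma minimal_no_pair: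
  assumes D: "D \<in> C" and min: "\<And>D'. D' \<in> C \<Longrightarrow> (\<Sum>j\<in>{0..<n}. D j * D j) \<le> (\<Sum>j\<in>{0..<n}. D' j * D' j)"
    and d9: "d \<le> 9" and n7: "7 \<le> n" and pair: "D p = 3" "D (p + 2) = 3" "D (p + 1) \<le> 1"
    and sum6: "D (p - 2) + D (p - 1) + D (p + 1) + D (p + 3) + D (p + 4) \<le> 3"
  shows False
proof -
  let ?S = "{p - 2, p - 1, p, p + 1, p + 2, p + 3, p + 4}"
  let ?f = "\<lambda>j. chip p j + chip (p + 2) j"
  have lap: "lap ?f j = 3 * of_bool (j = p) + 3 * of_bool (j = p + 2) - 2 * of_bool (j = p + 1)
      - of_bool (j = p - 1) - of_bool (j = p - 2) - of_bool (j = p + 3) - of_bool (j = p + 4)"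
    if "p - 2 \<le> j" "j < p - 2 + n" for j
    using that n7 by (simp add: lap_add lap_chip chip_near algebra_simps)
  have "0 \<le> (\<Sum>j\<in>?S. lap ?f j * lap ?f j - 2 * D j * lap ?f j)"
  proof (rule square_sum_change[OF D min, of _ "p - 2"])
    show "periodic n ?f" by (intro periodic_add chip_periodic)
    show "lap ?f j \<le> D j" if "p - 2 \<le> j" "j < p - 2 + n" for j
      using lap[OF that] nonneg[OF D, of j] pair by (cases "j = p"; cases "j = p + 2") auto
  qed (use n7 lap in auto)
  then show False using pair sum6 n7 by (simp add: lap)
qed

text \<open>Firing the three vertices changes the sum of squares by at most
  \<open>10 - 8 * D (p + 2)\<close>, which is at most \<open>- 6\<close>.\<close>

lemma minimal_no_triple:
  assumes D: "D \<in> C" and min: "\<And>D'. D' \<in> C \<Longrightarrow> (\<Sum>j\<in>{0..<n}. D j * D j) \<le> (\<Sum>j\<in>{0..<n}. D' j * D' j)"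
    and n9: "9 \<le> n" and triple: "D p = 3" "2 \<le> D (p + 2)" "D (p + 4) = 3"
    and sum: "D (p - 2) + D (p - 1) + D (p + 1) + D (p + 2) + D (p + 3) + D (p + 5) + D (p + 6) \<le> 3"
  shows False
proof -
  let ?S = "{p - 2, p - 1, p, p + 1, p + 2, p + 3, p + 4, p + 5, p + 6}"
  let ?f = "\<lambda>j. chip p j + chip (p + 2) j + chip (p + 4) j"
  have lap: "lap ?f j = 3 * of_bool (j = p) + 2 * of_bool (j = p + 2) + 3 * of_bool (j = p + 4)
      - 2 * of_bool (j = p + 1) - 2 * of_bool (j = p + 3)
      - of_bool (j = p - 1) - of_bool (j = p - 2) - of_bool (j = p + 5) - of_bool (j = p + 6)"
    if "p - 2 \<le> j" "j < p - 2 + n" for j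
    using that n9 by (simp add: lap_add lap_chip chip_near algebra_simps)
  have "0 \<le> (\<Sum>j\<in>?S. lap ?f j * lap ?f j - 2 * D j * lap ?f j)"
  proof (rule square_sum_change[OF D min, of _ "p - 2"])
    show "periodic n ?f" by (intro periodic_add chip_periodic)
    show "lap ?f j \<le> D j" if "p - 2 \<le> j" "j < p - 2 + n" for j
      using lap[OF that] nonneg[OF D, of j] triple by (cases "j = p"; cases "j = p + 2"; cases "j = p + 4") auto
  qed (use n9 lap in auto)
  then show False
    using triple sum n9 nonneg[OF D, of "p - 2"] nonneg[OF D, of "p - 1"] nonneg[OF D, of "p + 1"]
      nonneg[OF D, of "p + 3"] nonneg[OF D, of "p + 5"] nonneg[OF D, of "p + 6"] by (simp add: lap)
qed

lemma no_interval:
  assumes D: "D \<in> C" and d9: "d \<le> 9" and flat: "\<And>j. D j \<le> 3" and slack: "slack D i"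
    and large: "d = 6 \<Longrightarrow> 11 \<le> n" "d = 7 \<Longrightarrow> 12 \<le> n" "d = 8 \<Longrightarrow> 15 \<le> n" "d = 9 \<Longrightarrow> 16 \<le> n"
    and pq0: "i + 2 \<le> p0" "p0 < q0" "q0 < i + n" "\<And>j. lfront p0 j + rfront q0 j \<le> D j"
  shows False
proof -
  \<comment> \<open>A longest legal arc avoiding \<open>i\<close> is chosen: two chips just beyond
    an end would allow an extension. This gives the outer half of \<open>capped\<close>.\<close>
  define P where "P m \<longleftrightarrow> (\<exists>p q. m = nat (q - p) \<and> i + 2 \<le> p \<and> p < q \<and> q < i + n \<and> (\<forall>j. lfront p j + rfront q j \<le> D j))" for m
  have "P (nat (q0 - p0))" using pq0 unfolding P_def by blast
  moreover have "\<forall>m. P m \<longrightarrow> m \<le> nat n" by (auto simp: P_def)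
  ultimately obtain m where m: "P m" "\<And>m'. P m' \<Longrightarrow> m' \<le> m"
    by (metis (no_types, lifting) GreatestI_nat Greatest_le_nat)
  then obtain p q where pq: "m = nat (q - p)" "i + 2 \<le> p" "p < q" "q < i + n" "\<And>j. lfront p j + rfront q j \<le> D j"
    unfolding P_def by blast
  have right: "D (q + 1) \<le> 1"
  proof (rule ccontr)
    assume *: "\<not> ?thesis"
    show False
    proof (cases "q + 1 = i + n")
      case True
      then have "D (q + 1) = D i" using per[OF D] by (simp add: periodic_def)
      then show False using * slack by (simp add: slack_def)
    next
      case False
      have "lfront p j + rfront (q + 1) j \<le> D j" for j
        using pq(5)[of j] * pq(3) nonneg[OF D, of j] unfolding lfront_def rfront_def by (smt (verit))
      then have "P (nat (q + 1 - p))" using pq False unfolding P_def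
        by (intro exI[of _ p] exI[of _ "q + 1"]) auto
      then show False using m(2)[of "nat (q + 1 - p)"] pq(1,3) by linarith
    qed
  qed
  have left: "D (p - 1) \<le> 1"
  proof (rule ccontr)
    assume *: "\<not> ?thesis"
    show False
    proof (cases "p - 1 = i + 1")
      case True
      then show False using * slack by (auto simp: slack_def algebra_simps)
    next
      case False
      have "lfront (p - 1) j + rfront q j \<le> D j" for j
        using pq(5)[of j] * pq(3) nonneg[OF D, of j] unfolding lfront_def rfront_def by (smt (verit))
      then have "P (nat (q - (p - 1)))" using pq False unfolding P_def
        by (intro exI[of _ "p - 1"] exI[of _ q]) auto
      then show False using m(2)[of "nat (q - (p - 1))"] pq(1,3) by linarith
    qed
  qed
  define E where "E j = D j - ends p q j" for j
  have win: "ends p q j = lfront p j + rfront q j" if "i \<le> j" "j < i + n" for j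
    using ends_window[of i j p q] that pq by simp
  have perE: "periodic n E"
    using per[OF D] ends_periodic by (simp add: E_def periodic_def)
  have "0 \<le> E j" for j
    by (rule nonneg_if_window[OF perE, of i]) (use win pq in \<open>simp add: E_def\<close>)
  then have St: "state D p q E"
    using D pq by (auto simp: state_def E_def)
  have le: "E j \<le> D j" for j
  proof -
    have "0 \<le> ends p q j" by (simp add: ends_def)
    then show ?thesis by (simp add: E_def)
  qed
  have "E p \<le> 1" "E q \<le> 1"
    using flat[of p] flat[of q] win[of p] win[of q] pq by (auto simp: E_def lfront_def rfront_def)
  then have "capped p q E"
    using le[of "p - 1"] le[of "q + 1"] left right by (simp add: capped_def)
  with St show False using state_impossible d9 large by blast
qed

lemma degree_bound:
  assumes "d \<le> 9" "d = 4 \<Longrightarrow> 7 \<le> n" "d = 5 \<Longrightarrow> 8 \<le> n" "d = 6 \<Longrightarrow> 11 \<le> n" "d = 7 \<Longrightarrow> 12 \<le> n"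
    "d = 8 \<Longrightarrow> 15 \<le> n" "d = 9 \<Longrightarrow> 16 \<le> n"
  shows False
proof -
  have "\<exists>D. D \<in> C \<and> (\<forall>D'. D' \<in> C \<longrightarrow> nat (\<Sum>j\<in>{0..<n}. D j * D j) \<le> nat (\<Sum>j\<in>{0..<n}. D' j * D' j))"
    by (rule ex_has_least_nat[where P = "\<lambda>D. D \<in> C", OF some_in_eq[THEN iffD2, OF nonempty]])
  then obtain D where D: "D \<in> C"
    and least: "\<And>D'. D' \<in> C \<Longrightarrow> nat (\<Sum>j\<in>{0..<n}. D j * D j) \<le> nat (\<Sum>j\<in>{0..<n}. D' j * D' j)"
    by blast
  have min: "(\<Sum>j\<in>{0..<n}. D j * D j) \<le> (\<Sum>j\<in>{0..<n}. D' j * D' j)" if "D' \<in> C" for D'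
    using least[OF that] sum_nonneg[of "{0..<n}" "\<lambda>j. D' j * D' j"] by simp
  have flat: "D j \<le> 3" for j by (rule minimal_flat[OF D min assms(1)])
  show False
  proof (cases "\<exists>i. slack D i")
    case True
    then obtain i where slack: "slack D i" ..
    from D assms(1) flat slack show False
    proof (cases rule: legal_pattern)
      case (interval p q)
      then show False using no_interval[OF D assms(1) flat slack assms(4-7)] by blast
    next
      case (pair p)
      have "D p + D (p + 2) \<le> d" using sum_le_degree[OF D, of "{p, p + 2}" p] n5 by simp
      then have n: "11 \<le> n" using pair assms by (cases "d = 6"; cases "d = 7"; cases "d = 8"; cases "d = 9") auto
      have "(\<Sum>j\<in>{p - 2, p - 1, p, p + 1, p + 2, p + 3, p + 4}. D j) \<le> d"
        by (rule sum_le_degree[OF D, of _ "p - 2"]) (use n in auto)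
      then show False
        using minimal_no_pair[OF D min assms(1) _ pair(3-5)] pair n assms(1) by simp
    next
      case (triple p)
      have "D p + D (p + 2) + D (p + 4) \<le> d"
        using sum_le_degree[OF D, of "{p, p + 2, p + 4}" i] triple by simp
      then have n: "15 \<le> n" using triple assms by (cases "d = 8"; cases "d = 9") auto
      have "(\<Sum>j\<in>{p - 2, p - 1, p, p + 1, p + 2, p + 3, p + 4, p + 5, p + 6}. D j) \<le> d"
        by (rule sum_le_degree[OF D, of _ "p - 2"]) (use n in auto)
      then show False
        using minimal_no_triple[OF D min _ triple(3-5)] triple n assms(1) by simp
    next
      case (right_hook p q)
      then show False using no_right_hook[OF D assms(1) flat, of p q] assms(6,7) by auto
    next
      case (left_hook p q)
      then show False using no_left_hook[OF D assms(1) flat, of p q] assms(6,7) by auto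
    qed
  next
    case False
    \<comment> \<open>If \<open>D\<close> vanished everywhere, every vertex would be slack.\<close>
    then obtain x where x: "D x \<noteq> 0" by (auto simp: slack_def)
    have "D (x + n) = D x" "D (x + n + 1) = D (x + 1)"
      using per[OF D] unfolding periodic_def by (simp, metis add.assoc add.commute)
    then have "zero_flow D (x + n) = zero_flow D x" by (simp add: zero_flow_def)
    \<comment> \<open>Around the whole cycle the two flow terms cancel.\<close>
    moreover have "2 * (x + n - (x + 1) + 1) + zero_flow D (x + 1 - 1) - zero_flow D (x + n)
        \<le> 3 * (\<Sum>j\<in>{x + 1..x + n}. D j)"
      by (rule count_no_slack_flow) (use n5 nonneg[OF D] False x in auto)
    moreover have "{x + 1..x + n} = {x + 1..<x + 1 + n}" by auto
    ultimately have "2 * n \<le> 3 * d" using degree_window[OF D, of "x + 1"] by simp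
    then show False
      using assms n5 by (cases "d = 4"; cases "d = 5"; cases "d = 6"; cases "d = 7"; cases "d = 8"; cases "d = 9") auto
  qed
qed

end

section \<open>Divisors on Harary graphs as periodic functions\<close>

lemma periodic_eqI:
  assumes "periodic n f" "periodic n g" "0 < n" "\<And>j. w \<le> j \<Longrightarrow> j < w + n \<Longrightarrow> f j = g j"
  shows "f = g"
proof
  fix x
  have "f (w + (x - w) mod n) = g (w + (x - w) mod n)" using assms(3) by (intro assms(4)) auto
  then show "f x = g x" using periodic_mod[OF assms(1)] periodic_mod[OF assms(2)] by simp
qed

lemma residue_iff:
  fixes r c m :: int
  assumes "0 \<le> r" "r < m" "- m < c" "c < m"
  shows "(r - c) mod m = 0 \<longleftrightarrow> r = c \<or> r = c + m"
proof -
  consider "r < c" | "c \<le> r" "r < c + m" | "c + m \<le> r" by linarith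
  then show ?thesis
  proof cases
    case 1
    then have "(r - c + m) mod m = r - c + m" using assms by (intro mod_pos_pos_trivial) auto
    then show ?thesis using 1 assms by simp
  next
    case 2
    then show ?thesis by simp
  next
    case 3
    then have "(r - c - m) mod m = r - c - m" using assms by (intro mod_pos_pos_trivial) auto
    then have "(r - c) mod m = r - c - m" by simp
    then show ?thesis using 3 by auto
  qed
qed

definition unroll :: "nat \<Rightarrow> (nat \<Rightarrow> int) \<Rightarrow> int \<Rightarrow> int" where
  "unroll N D j = D (nat ((j - 1) mod int N) + 1)"

locale harary =
  fixes N :: nat
  assumes N5: "5 \<le> N"

sublocale harary \<subseteq> cyclic "int N"
  by unfold_locales (use N5 in simp)

context harary begin

lemma vertices_harary: "vertices (harary4 N) = {1..N}"
  by (simp add: harary4_def)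

lemma unroll_periodic: "periodic (int N) (unroll N D)"
proof -
  have "(i + int N - 1) mod int N = (i - 1) mod int N" for i
    using mod_add_self2[of "i - 1" "int N"] by (simp add: algebra_simps)
  then show ?thesis by (simp add: periodic_def unroll_def)
qed

lemma unroll_vertex [simp]: "v \<in> {1..N} \<Longrightarrow> unroll N D (int v) = D v"
  by (simp add: unroll_def nat_diff_distrib)

lemma unroll_eqI:
  assumes "periodic (int N) F" "\<And>v. v \<in> {1..N} \<Longrightarrow> D v = F (int v)"
  shows "unroll N D = F"
proof (rule periodic_eqI[OF unroll_periodic assms(1), of 1])
  fix j :: int assume "1 \<le> j" "j < 1 + int N"
  then obtain v where "j = int v" "v \<in> {1..N}" by (intro that[of "nat j"]) auto
  then show "unroll N D j = F j" using assms(2) by simp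
qed (use N5 in simp)

lemma vertex_sum:
  assumes "periodic (int N) F"
  shows "(\<Sum>v\<in>{1..N}. F (int v)) = (\<Sum>j\<in>{0..<int N}. F j :: int)"
proof -
  have "(\<Sum>v\<in>{1..N}. F (int v)) = (\<Sum>j\<in>{1..<1 + int N}. F j)"
    by (rule sum.reindex_bij_witness[of _ nat int]) auto
  then show ?thesis using sum_window_class[OF assms, of 1] by simp
qed

lemma unroll_add_chip:
  assumes "q \<in> {1..N}"
  shows "unroll N (D(q := D q + c)) = (\<lambda>j. unroll N D j + c * chip (int q) j)"
proof (rule unroll_eqI)
  show "periodic (int N) (\<lambda>j. unroll N D j + c * chip (int q) j)"
    using unroll_periodic chip_periodic by (simp add: periodic_def)
  show "(D(q := D q + c)) v = unroll N D (int v) + c * chip (int q) (int v)" if "v \<in> {1..N}" for v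
    using that assms by (simp add: chip_near)
qed

text \<open>For \<open>N \<ge> 5\<close> the offsets 1, 2, -1, -2 are distinct modulo
  \<open>N\<close>, so the sum of four indicators never exceeds 1.\<close>

lemma adjacent_chips:
  assumes "v \<in> {1..N}" "w \<in> {1..N}"
  shows "of_bool (harary4_adj N v w) = chip (int v - 1) (int w) + chip (int v + 1) (int w)
    + chip (int v - 2) (int w) + chip (int v + 2) (int w)"
proof -
  define r where "r = (int w - int v) mod int N"
  have r: "0 \<le> r" "r < int N" using N5 by (auto simp: r_def)
  have chip_r: "chip (int v + c) (int w) = of_bool (r = c \<or> r = c + int N)" if "- 2 \<le> c" "c \<le> 2" for c
  proof -
    have "(int w - (int v + c)) mod int N = (r - c) mod int N"
      by (simp add: r_def mod_diff_left_eq diff_diff_eq)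
    then show ?thesis using residue_iff[of r "int N" c] r that N5 by (simp add: chip_def)
  qed
  have "(int v - int w) mod int N = (if r = 0 then 0 else int N - r)"
    using zmod_zminus1_eq_if[of "int w - int v" "int N"] by (simp add: r_def)
  then show ?thesis
    using chip_r[of 1] chip_r[of "-1"] chip_r[of 2] chip_r[of "-2"] assms r N5
    by (auto simp: harary4_adj_def r_def[symmetric])
qed

lemma fire_unroll:
  assumes v: "v \<in> {1..N}"
  shows "unroll N (fire (harary4 N) v D) = (\<lambda>j. unroll N D j - lap (chip (int v)) j)"
proof (rule unroll_eqI)
  show "periodic (int N) (\<lambda>j. unroll N D j - lap (chip (int v)) j)"
    using unroll_periodic lap_periodic[OF chip_periodic] by (simp add: periodic_def)
  have adj: "int (mult (harary4 N) v w) = chip (int v - 1) (int w) + chip (int v + 1) (int w)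
    + chip (int v - 2) (int w) + chip (int v + 2) (int w)" if "w \<in> {1..N}" for w
    using adjacent_chips[OF v that] by (simp add: harary4_def)
  have "(\<Sum>u\<in>{1..N}. int (mult (harary4 N) v u)) = (\<Sum>u\<in>{1..N}. chip (int v - 1) (int u) + chip (int v + 1) (int u)
    + chip (int v - 2) (int u) + chip (int v + 2) (int u))"
    by (rule sum.cong) (use adj in auto)
  also have "\<dots> = 4" by (simp only: sum.distrib vertex_sum chip_periodic chip_sum)
  finally have deg4: "(\<Sum>u\<in>{1..N}. int (mult (harary4 N) v u)) = 4" .
  have loopless: "mult (harary4 N) v v = 0" by (simp add: harary4_def harary4_adj_def)
  show "fire (harary4 N) v D w = unroll N D (int w) - lap (chip (int v)) (int w)" if w: "w \<in> {1..N}" for w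
    using adj[OF w] deg4 loopless v w
    by (auto simp: fire_def lap_chip vertices_harary chip_near)
qed

lemma equivalent_unroll:
  assumes "equivalent (harary4 N) D D'"
  shows "\<exists>f. periodic (int N) f \<and> unroll N D' = (\<lambda>j. unroll N D j - lap f j)"
  using assms unfolding equivalent_def
proof (induction rule: rtranclp_induct)
  case base
  show ?case by (rule exI[of _ "\<lambda>_. 0"]) (simp add: periodic_def lap_def)
next
  case (step D1 D2)
  then obtain f v where "periodic (int N) f" "unroll N D1 = (\<lambda>j. unroll N D j - lap f j)"
    "v \<in> {1..N}" "D2 = fire (harary4 N) v D1"
    by (auto simp: vertices_harary)
  then show ?case
    using fire_unroll[of v D1] periodic_add[OF _ chip_periodic]
    by (intro exI[of _ "\<lambda>j. f j + chip (int v) j"]) (simp add: lap_add algebra_simps)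
qed

text \<open>\<open>equivalent\<close> only allows firing, whereas \<open>f\<close> may be negative.
  A constant has zero Laplacian, so \<open>f\<close> can be made nonnegative; then induct on the
  total number of firings.\<close>

lemma equivalentI:
  assumes "periodic (int N) f" "unroll N D' = (\<lambda>j. unroll N D j - lap f j)" "\<And>v. v \<notin> {1..N} \<Longrightarrow> D' v = D v"
  shows "equivalent (harary4 N) D D'"
proof -
  have nonneg_script: "equivalent (harary4 N) D D'"
    if "periodic (int N) f" "\<And>j. 0 \<le> f j" "unroll N D' = (\<lambda>j. unroll N D j - lap f j)" "\<And>v. v \<notin> {1..N} \<Longrightarrow> D' v = D v"
      "nat (\<Sum>v\<in>{1..N}. f (int v)) = k" for f D k
    using that
  proof (induction k arbitrary: f D)
    case 0
    then have "f (int v) = 0" if "v \<in> {1..N}" for v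
      using that sum_nonneg_eq_0_iff[of "{1..N}" "\<lambda>v. f (int v)"] sum_nonneg[of "{1..N}" "\<lambda>v. f (int v)"] by simp
    then have "f = (\<lambda>_. 0)" using unroll_eqI[OF 0(1), of "\<lambda>_. 0"] by (auto simp: unroll_def)
    then have "unroll N D' = unroll N D" using 0(3) by (simp add: lap_def)
    then have "D' v = D v" if "v \<in> {1..N}" for v using unroll_vertex[OF that, of D'] unroll_vertex[OF that, of D] by simp
    then have "D' = D" using 0(4) by blast
    then show ?case by (simp add: equivalent_def)
  next
    case (Suc k)
    have "\<exists>v\<in>{1..N}. 0 < f (int v)"
    proof (rule ccontr)
      assume "\<not> ?thesis"
      then have "(\<Sum>v\<in>{1..N}. f (int v)) \<le> 0" by (intro sum_nonpos) (simp add: not_less)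
      then show False using Suc.prems(5) by simp
    qed
    then obtain v where v: "v \<in> {1..N}" "0 < f (int v)" ..
    let ?f = "\<lambda>j. f j - chip (int v) j"
    have per: "periodic (int N) ?f" using Suc.prems(1) chip_periodic by (simp add: periodic_def)
    have "equivalent (harary4 N) (fire (harary4 N) v D) D'"
    proof (rule Suc.IH[OF per])
      show "0 \<le> ?f j" for j
      proof (rule nonneg_if_window[OF per, of 1])
        fix j assume "1 \<le> j" "j < 1 + int N"
        then show "0 \<le> ?f j" using v Suc.prems(2)[of j] by (cases "j = int v") (simp_all add: chip_near)
      qed
      show "unroll N D' = (\<lambda>j. unroll N (fire (harary4 N) v D) j - lap ?f j)"
        using Suc.prems(3) by (simp add: fire_unroll[OF v(1)] lap_diff)
      show "D' w = fire (harary4 N) v D w" if "w \<notin> {1..N}" for w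
        using Suc.prems(4)[OF that] that v(1) by (auto simp: fire_def harary4_def harary4_adj_def)
      have "(\<Sum>w\<in>{1..N}. ?f (int w)) = (\<Sum>w\<in>{1..N}. f (int w)) - 1"
        by (simp only: sum_subtractf vertex_sum chip_periodic chip_sum)
      then show "nat (\<Sum>w\<in>{1..N}. ?f (int w)) = k" using Suc.prems(5) by simp
    qed
    then show ?case
      unfolding equivalent_def
    proof (rule converse_rtranclp_into_rtranclp[rotated])
      show "\<exists>u\<in>vertices (harary4 N). fire (harary4 N) v D = fire (harary4 N) u D"
        using v(1) by (auto simp: vertices_harary)
    qed
  qed
  define c where "c = (\<Sum>v\<in>{1..N}. \<bar>f (int v)\<bar>)"
  have per: "periodic (int N) (\<lambda>j. f j + c)" using assms(1) by (simp add: periodic_def)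
  have "0 \<le> f j + c" for j
  proof (rule nonneg_if_window[OF per, of 1])
    fix j assume "1 \<le> j" "j < 1 + int N"
    then have "\<bar>f (int (nat j))\<bar> \<le> c" unfolding c_def
      by (intro member_le_sum) auto
    then show "0 \<le> f j + c" using \<open>1 \<le> j\<close> by simp
  qed
  moreover have "lap (\<lambda>j. f j + c) = lap f" by (simp add: lap_def fun_eq_iff)
  ultimately show ?thesis using assms(2) by (intro nonneg_script[OF per _ _ assms(3) refl]) simp_all
qed

end

section \<open>Divisors of positive rank\<close>

context cyclic begin

lemma lap_sum:
  assumes "periodic n f"
  shows "(\<Sum>j\<in>{0..<n}. lap f j) = 0"
proof -
  have shift: "(\<Sum>j\<in>{0..<n}. f (j + c)) = (\<Sum>j\<in>{0..<n}. f j)" for c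
  proof -
    have "(\<Sum>j\<in>{0..<n}. f (j + c)) = (\<Sum>j\<in>{c..<c + n}. f j)"
      by (rule sum.reindex_bij_witness[of _ "\<lambda>j. j - c" "\<lambda>j. j + c"]) auto
    then show ?thesis using sum_window_class[OF assms] by simp
  qed
  show ?thesis
    using shift[of 1] shift[of "-1"] shift[of 2] shift[of "-2"]
    by (simp add: lap_def sum_subtractf flip: sum_distrib_left)
qed

definition linked :: "(int \<Rightarrow> int) \<Rightarrow> (int \<Rightarrow> int) \<Rightarrow> bool" where
  "linked F F' \<longleftrightarrow> (\<exists>f. periodic n f \<and> F' = (\<lambda>j. F j - lap f j))"

lemma linked_refl: "linked F F"
  unfolding linked_def by (rule exI[of _ "\<lambda>_. 0"]) (simp add: periodic_def lap_def)

lemma linked_trans: "linked F G \<Longrightarrow> linked G H \<Longrightarrow> linked F H"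
  unfolding linked_def
proof (elim exE conjE)
  fix f g assume "periodic n f" "periodic n g" "G = (\<lambda>j. F j - lap f j)" "H = (\<lambda>j. G j - lap g j)"
  then show "\<exists>h. periodic n h \<and> H = (\<lambda>j. F j - lap h j)"
    by (intro exI[of _ "\<lambda>j. f j + g j"]) (simp add: periodic_add lap_add fun_eq_iff)
qed

section \<open>Explicit divisors for the upper bound\<close>

definition pile :: "int list \<Rightarrow> int \<Rightarrow> int" where
  "pile cs j = (\<Sum>c\<leftarrow>cs. chip c j)"

lemma pile_simps [simp]: "pile [] j = 0" "pile (c # cs) j = chip c j + pile cs j"
  by (simp_all add: pile_def)

lemma pile_nonneg: "0 \<le> pile cs j"
  by (induction cs) simp_all

lemma pile_periodic: "periodic n (pile cs)"
  using chip_periodic by (simp add: periodic_def pile_def)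

lemma pile_sum: "(\<Sum>j\<in>{0..<n}. pile cs j) = int (length cs)"
  by (induction cs) (simp_all add: sum.distrib chip_sum)

lemma pile_member: "x \<in> set cs \<Longrightarrow> 1 \<le> pile cs x"
proof (induction cs)
  case (Cons c cs)
  then show ?case using pile_nonneg[of cs x] by (auto simp: chip_def)
qed simp

text \<open>The firing is stated as an equality of sums without subtraction, so that comparing chips
  proves it; \<open>covers\<close> asks for effectiveness only at the end.\<close>

lemma linked_block:
  assumes "a \<le> b" "\<And>j. pile cs' j + ends a b j = pile cs j + ends (b + 1) (a - 1) j"
  shows "linked (pile cs) (pile cs')"
  unfolding linked_def
proof (intro exI conjI ext)
  show "pile cs' j = pile cs j - lap (block a b) j" for j
    using assms(2)[of j] by (simp add: lap_block[OF assms(1)])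
qed (rule block_periodic)

definition covers :: "(int \<Rightarrow> int) \<Rightarrow> int \<Rightarrow> bool" where
  "covers F x \<longleftrightarrow> (\<exists>F'. linked F F' \<and> (\<forall>j. 0 \<le> F' j) \<and> 1 \<le> F' x)"

lemma covers_pile: "linked F (pile cs) \<Longrightarrow> x \<in> set cs \<Longrightarrow> covers F x"
  unfolding covers_def using pile_nonneg pile_member by blast

text \<open>A stack 1, 3, 1 travels unchanged: its inner foot and two chips of its middle are fired,
  leaving 1, 1, and the arriving 2, 1 restore 1, 3, 1 one step further out.\<close>

lemma covers_10: "covers (pile [-1, 0, 0, 0, 1, 0, 1, 1, 1, 2]) (1 + int k)"
proof -
  let ?T = "\<lambda>k. [- k - 1, - k, - k, - k, - k + 1, k, k + 1, k + 1, k + 1, k + 2]"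
  have "linked (pile (?T 0)) (pile (?T (int k)))"
  proof (induction k)
    case 0
    show ?case by (simp add: linked_refl)
  next
    case (Suc k)
    have e: "chip (- 1 - int k) = chip (- int k - 1)" by (rule arg_cong[of _ _ chip]) simp
    have "linked (pile (?T (int k))) (pile (?T (int (Suc k))))"
      by (rule linked_block[of "- int k" "int k + 1"]) (simp_all add: ends_def algebra_simps e)
    with Suc show ?case by (rule linked_trans)
  qed
  then show ?thesis by (intro covers_pile[of _ "?T (int k)"]) simp_all
qed

lemma covers_5:
  assumes "- 2 \<le> x" "x \<le> 2"
  shows "covers (pile [0, 0, 0, 0]) x"
proof -
  have 1: "linked (pile [0, 0, 0, 0]) (pile [-2, -1, 1, 2])"
    by (rule linked_block[of 0 0]) (simp_all add: ends_def)
  have "x \<in> set [0, 0, 0, 0] \<or> x \<in> set [-2, -1, 1, 2]" using assms by auto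
  then show ?thesis using covers_pile[OF linked_refl] covers_pile[OF 1] by blast
qed

text \<open>Firing everything except vertex 3 makes it collect one chip from each of its four
  neighbours. Lengths 10 and 14 end in the same way.\<close>

lemma covers_6:
  assumes "n = 6" "- 2 \<le> x" "x \<le> 3"
  shows "covers (pile [0, 0, 0, 0]) x"
proof (cases "x = 3")
  case True
  have w: "chip (-3) = chip 3" "chip 4 = chip (-2)" "chip (-4) = chip 2"
    using chip_add_period[of "-3"] chip_add_period[of "-2"] chip_add_period[of "-4"] assms(1) by simp_all
  have "linked (pile [0, 0, 0, 0]) (pile [-2, -1, 1, 2])"
    by (rule linked_block[of 0 0]) (simp_all add: ends_def)
  moreover have "linked (pile [-2, -1, 1, 2]) (pile [3, 3, 3, 3])"
    by (rule linked_block[of "-2" 2]) (simp_all add: ends_def w)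
  ultimately show ?thesis using covers_pile[OF linked_trans, of _ _ "[3, 3, 3, 3]" x] True by simp
qed (use assms covers_5 in auto)

text \<open>On an odd cycle the last uncovered vertex has neighbours that are not symmetric about 0;
  the extra chip on 3 stands on the one left empty. Lengths 11 and 15 use the same device.\<close>

lemma covers_7:
  assumes "n = 7" "- 2 \<le> x" "x \<le> 4"
  shows "covers (pile [0, 0, 0, 0, 3]) x"
proof -
  have w: "chip (-3) = chip 4" "chip 5 = chip (-2)" "chip (-4) = chip 3"
    using chip_add_period[of "-3"] chip_add_period[of "-2"] chip_add_period[of "-4"] assms(1) by simp_all
  have 1: "linked (pile [0, 0, 0, 0, 3]) (pile [-2, -1, 1, 2, 3])"
    by (rule linked_block[of 0 0]) (simp_all add: ends_def)
  have "linked (pile [-2, -1, 1, 2, 3]) (pile [1, 4, 4, 4, 4])"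
    by (rule linked_block[of "-2" 3]) (simp_all add: ends_def w)
  note 2 = linked_trans[OF 1 this]
  have "x \<in> set [0, 0, 0, 0, 3] \<or> x \<in> set [-2, -1, 1, 2, 3] \<or> x \<in> set [1, 4, 4, 4, 4]"
    using assms(2,3) by auto
  then show ?thesis using covers_pile[OF linked_refl] covers_pile[OF 1] covers_pile[OF 2] by blast
qed

text \<open>After vertex 0 is fired, the chips waiting on \<open>-2\<close> and \<open>2\<close>
  complete the two halves to fronts 2, 1, so the arc between them can be fired.\<close>

lemma spread:
  "linked (pile (-2 # 0 # 0 # 0 # 0 # 2 # cs)) (pile (-2 # -2 # -1 # 1 # 2 # 2 # cs))"
  "linked (pile (-2 # 0 # 0 # 0 # 0 # 2 # cs)) (pile (-4 # -3 # -3 # 3 # 3 # 4 # cs))"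
proof -
  show 1: "linked (pile (-2 # 0 # 0 # 0 # 0 # 2 # cs)) (pile (-2 # -2 # -1 # 1 # 2 # 2 # cs))"
    by (rule linked_block[of 0 0]) (simp_all add: ends_def)
  have "linked (pile (-2 # -2 # -1 # 1 # 2 # 2 # cs)) (pile (-4 # -3 # -3 # 3 # 3 # 4 # cs))"
    by (rule linked_block[of "-2" 2]) (simp_all add: ends_def)
  with 1 show "linked (pile (-2 # 0 # 0 # 0 # 0 # 2 # cs)) (pile (-4 # -3 # -3 # 3 # 3 # 4 # cs))"
    by (rule linked_trans)
qed

lemma covers_spread:
  assumes "- 4 \<le> x" "x \<le> 4"
  shows "covers (pile (-2 # 0 # 0 # 0 # 0 # 2 # cs)) x"
proof -
  have "x \<in> {-4, -3, -2, -1, 0, 1, 2, 3, 4}" using assms by auto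
  then have "x \<in> set (-2 # 0 # 0 # 0 # 0 # 2 # cs) \<or> x \<in> set (-2 # -2 # -1 # 1 # 2 # 2 # cs)
      \<or> x \<in> set (-4 # -3 # -3 # 3 # 3 # 4 # cs)"
    by (simp only: set_simps insert_iff empty_iff) blast
  then show ?thesis
    using covers_pile[OF linked_refl] covers_pile[OF spread(1)] covers_pile[OF spread(2)] by blast
qed

lemma covers_10_cycle:
  assumes "n = 10" "- 4 \<le> x" "x \<le> 5"
  shows "covers (pile [-2, 0, 0, 0, 0, 2]) x"
proof (cases "x = 5")
  case True
  have w: "chip 6 = chip (-4)" "chip (-6) = chip 4"
    using chip_add_period[of "-4"] chip_add_period[of "-6"] assms(1) by simp_all
  have "linked (pile [-4, -3, -3, 3, 3, 4]) (pile [-5, -5, -3, 3, 5, 5])"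
    by (rule linked_block[of "-4" 4]) (simp_all add: ends_def w)
  then show ?thesis using covers_pile[OF linked_trans[OF spread(2)]] True by simp
qed (use assms covers_spread in auto)

lemma covers_11_cycle:
  assumes "n = 11" "- 4 \<le> x" "x \<le> 6"
  shows "covers (pile [-2, 0, 0, 0, 0, 2, 5]) x"
proof (cases "x \<le> 4")
  case False
  have w: "chip 7 = chip (-4)" "chip (-6) = chip 5" "chip (-5) = chip 6"
    using chip_add_period[of "-4"] chip_add_period[of "-6"] chip_add_period[of "-5"] assms(1) by simp_all
  have "linked (pile [-4, -3, -3, 3, 3, 4, 5]) (pile [-3, 3, 3, 6, 6, 6, 6])"
    by (rule linked_block[of "-4" 5]) (simp_all add: ends_def w)
  note 1 = linked_trans[OF spread(2) this]
  have "x \<in> set [-4, -3, -3, 3, 3, 4, 5] \<or> x \<in> set [-3, 3, 3, 6, 6, 6, 6]" using False assms by auto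
  then show ?thesis using covers_pile[OF spread(2)] covers_pile[OF 1] by blast
qed (use assms covers_spread in auto)

text \<open>Chips waiting on \<open>-4\<close> and \<open>4\<close> do the same for the next
  step.\<close>

lemma spread_wide:
  "linked (pile (-2 # 0 # 0 # 0 # 0 # 2 # -4 # 4 # cs)) (pile (-6 # -5 # -5 # -3 # 3 # 5 # 5 # 6 # cs))"
proof -
  have "linked (pile (-4 # -3 # -3 # 3 # 3 # 4 # -4 # 4 # cs)) (pile (-6 # -5 # -5 # -3 # 3 # 5 # 5 # 6 # cs))"
    by (rule linked_block[of "-4" 4]) (simp_all add: ends_def)
  with spread(2) show ?thesis by (rule linked_trans)
qed

lemma covers_spread_wide:
  assumes "- 6 \<le> x" "x \<le> 6"
  shows "covers (pile (-2 # 0 # 0 # 0 # 0 # 2 # -4 # 4 # cs)) x"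
proof (cases "- 4 \<le> x \<and> x \<le> 4")
  case False
  then have "x \<in> {-6, -5, 5, 6}" using assms by auto
  then have "x \<in> set (-6 # -5 # -5 # -3 # 3 # 5 # 5 # 6 # cs)" by auto
  then show ?thesis by (rule covers_pile[OF spread_wide])
qed (use covers_spread in auto)

lemma covers_14_cycle:
  assumes "n = 14" "- 6 \<le> x" "x \<le> 7"
  shows "covers (pile [-2, 0, 0, 0, 0, 2, -4, 4]) x"
proof (cases "x = 7")
  case True
  have w: "chip 8 = chip (-6)" "chip (-8) = chip 6"
    using chip_add_period[of "-6"] chip_add_period[of "-8"] assms(1) by simp_all
  have "linked (pile [-6, -5, -5, -3, 3, 5, 5, 6]) (pile [-7, -7, -5, -3, 3, 5, 7, 7])"
    by (rule linked_block[of "-6" 6]) (simp_all add: ends_def w)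
  then show ?thesis using covers_pile[OF linked_trans[OF spread_wide]] True by simp
qed (use assms covers_spread_wide in auto)

lemma covers_15_cycle:
  assumes "n = 15" "- 6 \<le> x" "x \<le> 8"
  shows "covers (pile [-2, 0, 0, 0, 0, 2, -4, 4, 7]) x"
proof (cases "x \<le> 6")
  case False
  have w: "chip (-7) = chip 8" "chip 9 = chip (-6)" "chip (-8) = chip 7"
    using chip_add_period[of "-7"] chip_add_period[of "-6"] chip_add_period[of "-8"] assms(1) by simp_all
  have "linked (pile [-6, -5, -5, -3, 3, 5, 5, 6, 7]) (pile [-5, -3, 3, 5, 5, 8, 8, 8, 8])"
    by (rule linked_block[of "-6" 7]) (simp_all add: ends_def w)
  note 1 = linked_trans[OF spread_wide this]
  have "x \<in> set [-6, -5, -5, -3, 3, 5, 5, 6, 7] \<or> x \<in> set [-5, -3, 3, 5, 5, 8, 8, 8, 8]"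
    using False assms by auto
  then show ?thesis using covers_pile[OF spread_wide] covers_pile[OF 1] by blast
qed (use assms covers_spread_wide in auto)

end

definition roll :: "nat \<Rightarrow> (int \<Rightarrow> int) \<Rightarrow> nat \<Rightarrow> int" where
  "roll N F v = (if v \<in> {1..N} then F (int v) else 0)"

context harary begin

lemma unroll_roll: "periodic (int N) F \<Longrightarrow> unroll N (roll N F) = F"
  by (rule unroll_eqI) (simp_all add: roll_def)

text \<open>\<open>covers\<close> puts a chip on \<open>q\<close> and keeps the rest effective;
  removing that chip commutes with the script.\<close>

lemma positive_rank_roll:
  assumes per: "periodic (int N) F" and cov: "\<And>x. w \<le> x \<Longrightarrow> x < w + int N \<Longrightarrow> covers F x"
  shows "positive_rank (harary4 N) (roll N F)"
  unfolding positive_rank_def vertices_harary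
proof
  fix q assume q: "q \<in> {1..N}"
  let ?x = "w + (int q - w) mod int N"
  have "covers F ?x" by (rule cov) (use N5 in auto)
  then obtain F' f where f: "periodic (int N) f" "F' = (\<lambda>j. F j - lap f j)"
    and F': "\<And>j. 0 \<le> F' j" "1 \<le> F' ?x"
    by (auto simp: covers_def linked_def)
  have perF': "periodic (int N) F'"
    using per lap_periodic[OF f(1)] by (simp add: f(2) periodic_def)
  have q1: "1 \<le> F' (int q)" using F'(2) periodic_mod[OF perF', of w "int q"] by simp
  let ?R = "roll N F'" and ?D = "roll N F"
  let ?D' = "?R(q := ?R q + - 1)"
  have "equivalent (harary4 N) (?D(q := ?D q + - 1)) ?D'"
  proof (rule equivalentI[OF f(1)])
    show "unroll N ?D' = (\<lambda>j. unroll N (?D(q := ?D q + - 1)) j - lap f j)"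
      unfolding unroll_add_chip[OF q] unroll_roll[OF per] unroll_roll[OF perF'] by (simp add: f(2) fun_eq_iff)
  qed (use q in \<open>auto simp: roll_def\<close>)
  moreover have "effective (harary4 N) ?D'"
    using F'(1) q1 q by (auto simp: effective_def vertices_harary roll_def)
  ultimately show "\<exists>D'. equivalent (harary4 N) (?D(q := ?D q - 1)) D' \<and> effective (harary4 N) D'"
    by auto
qed

lemma pile_divisor:
  assumes "\<And>x. w \<le> x \<Longrightarrow> x < w + int N \<Longrightarrow> covers (pile cs) x"
  shows "\<exists>D\<in>divisors (harary4 N). positive_rank (harary4 N) D \<and> degree (harary4 N) D = int (length cs)"
proof (intro bexI conjI)
  show "positive_rank (harary4 N) (roll N (pile cs))"
    by (rule positive_rank_roll[OF pile_periodic assms])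
  have "degree (harary4 N) (roll N (pile cs)) = (\<Sum>v\<in>{1..N}. pile cs (int v))"
    unfolding degree_def vertices_harary by (rule sum.cong) (simp_all add: roll_def)
  also have "\<dots> = int (length cs)" using vertex_sum[OF pile_periodic] pile_sum by simp
  finally show "degree (harary4 N) (roll N (pile cs)) = int (length cs)" .
  show "roll N (pile cs) \<in> divisors (harary4 N)" by (simp add: divisors_def vertices_harary roll_def)
qed

end

section \<open>The gonality\<close>

context harary begin

lemma equivalent_off_vertices:
  assumes "equivalent (harary4 N) D D'" "v \<notin> {1..N}"
  shows "D' v = D v"
  using assms(1) unfolding equivalent_def
proof (induction rule: rtranclp_induct)
  case (step D1 D2)
  then show ?case using assms(2) by (auto simp: fire_def harary4_def harary4_adj_def)
qed simp

lemma unroll_nonneg: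
  assumes "effective (harary4 N) D"
  shows "0 \<le> unroll N D j"
proof (rule nonneg_if_window[OF unroll_periodic, of 1])
  fix j assume "1 \<le> j" "j < 1 + int N"
  then have v: "nat j \<in> {1..N}" "int (nat j) = j" by auto
  then show "0 \<le> unroll N D j"
    using assms unroll_vertex[OF v(1), of D] by (simp add: effective_def vertices_harary)
qed

lemma degree_unroll: "degree (harary4 N) D = (\<Sum>j\<in>{0..<int N}. unroll N D j)"
proof -
  have "degree (harary4 N) D = (\<Sum>v\<in>{1..N}. unroll N D (int v))"
    unfolding degree_def vertices_harary by (rule sum.cong) simp_all
  then show ?thesis using vertex_sum[OF unroll_periodic] by simp
qed

lemma positive_rank_effective:
  assumes rank: "positive_rank (harary4 N) D" and q: "q \<in> {1..N}"
  obtains D' where "equivalent (harary4 N) D D'" "effective (harary4 N) D'" "1 \<le> D' q"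
proof -
  have "\<exists>D1. equivalent (harary4 N) (D(q := D q + - 1)) D1 \<and> effective (harary4 N) D1"
    using rank q by (simp add: positive_rank_def vertices_harary)
  then obtain D1 where D1: "equivalent (harary4 N) (D(q := D q + - 1)) D1" "effective (harary4 N) D1"
    by blast
  obtain f where f: "periodic (int N) f" "unroll N D1 = (\<lambda>j. unroll N (D(q := D q + - 1)) j - lap f j)"
    using equivalent_unroll[OF D1(1)] by blast
  show thesis
  proof (rule that)
    show "equivalent (harary4 N) D (D1(q := D1 q + 1))"
    proof (rule equivalentI[OF f(1)])
      show "unroll N (D1(q := D1 q + 1)) = (\<lambda>j. unroll N D j - lap f j)"
        unfolding unroll_add_chip[OF q] f(2) by (simp add: fun_eq_iff)
      show "(D1(q := D1 q + 1)) v = D v" if "v \<notin> {1..N}" for v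
        using equivalent_off_vertices[OF D1(1) that] that q by auto
    qed
    show "effective (harary4 N) (D1(q := D1 q + 1))" "1 \<le> (D1(q := D1 q + 1)) q"
      using D1(2) q by (auto simp: effective_def vertices_harary)
  qed
qed

lemma effective_class:
  assumes rank: "positive_rank (harary4 N) D" and d: "degree (harary4 N) D = d"
  shows "positive_rank_class (int N) d {unroll N D' | D'. equivalent (harary4 N) D D' \<and> effective (harary4 N) D'}"
    (is "positive_rank_class _ _ ?C")
proof
  show "?C \<noteq> {}"
    using positive_rank_effective[OF rank, of 1] N5 by auto
next
  fix F assume "F \<in> ?C"
  then obtain D1 where D1: "F = unroll N D1" "equivalent (harary4 N) D D1" "effective (harary4 N) D1" by blast
  obtain f where f: "periodic (int N) f" "unroll N D1 = (\<lambda>j. unroll N D j - lap f j)"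
    using equivalent_unroll[OF D1(2)] by blast
  show "periodic (int N) F" by (simp add: D1(1) unroll_periodic)
  show "0 \<le> F i" for i by (simp add: D1(1) unroll_nonneg[OF D1(3)])
  show "(\<Sum>j\<in>{0..<int N}. F j) = d"
    using d by (simp add: D1(1) f(2) sum_subtractf lap_sum[OF f(1)] degree_unroll)
  show "(\<lambda>i. F i - lap g i) \<in> ?C" if g: "periodic (int N) g" "\<And>i. lap g i \<le> F i" for g
  proof -
    define D2 where "D2 v = (if v \<in> {1..N} then D1 v - lap g (int v) else D1 v)" for v
    have per: "periodic (int N) (\<lambda>i. F i - lap g i)"
      using unroll_periodic lap_periodic[OF g(1)] by (simp add: D1(1) periodic_def)
    have D2: "unroll N D2 = (\<lambda>i. F i - lap g i)"
      by (rule unroll_eqI[OF per]) (simp add: D1(1) D2_def)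
    have "equivalent (harary4 N) D1 D2"
      by (rule equivalentI[OF g(1)]) (use D2 in \<open>auto simp: D1(1) D2_def\<close>)
    then have "equivalent (harary4 N) D D2"
      using D1(2) unfolding equivalent_def by (rule rtranclp_trans[rotated])
    moreover have "effective (harary4 N) D2"
      using g(2)[of "int v" for v] unfolding effective_def vertices_harary
      by (metis D1(1) D2_def diff_ge_0_iff_ge unroll_vertex)
    ultimately show ?thesis using D2 by (intro CollectI exI[of _ D2]) simp
  qed
  show "\<exists>g. periodic (int N) g \<and> (\<lambda>i. F i - lap g i) \<in> ?C \<and> 1 \<le> F x - lap g x" for x
  proof -
    define q where "q = nat ((x - 1) mod int N) + 1"
    have q: "q \<in> {1..N}" using N5 by (simp add: q_def Suc_le_eq nat_less_iff)
    obtain D3 where D3: "equivalent (harary4 N) D D3" "effective (harary4 N) D3" "1 \<le> D3 q"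
      using positive_rank_effective[OF rank q] .
    obtain h where h: "periodic (int N) h" "unroll N D3 = (\<lambda>j. unroll N D j - lap h j)"
      using equivalent_unroll[OF D3(1)] by blast
    \<comment> \<open>Both divisors are reached from \<open>D\<close>, so the difference of the two
      scripts leads from one to the other.\<close>
    have eq: "unroll N D3 = (\<lambda>i. F i - lap (\<lambda>j. h j - f j) i)"
      by (simp add: D1(1) f(2) h(2) lap_diff)
    show ?thesis
    proof (intro exI conjI)
      show "periodic (int N) (\<lambda>j. h j - f j)" using f(1) h(1) by (simp add: periodic_def)
      show "(\<lambda>i. F i - lap (\<lambda>j. h j - f j) i) \<in> ?C" unfolding eq[symmetric] using D3 by blast
      have "unroll N D3 x = D3 q" by (simp add: unroll_def q_def)
      then show "1 \<le> F x - lap (\<lambda>j. h j - f j) x" using D3(3) by (simp add: eq)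
    qed
  qed
qed

lemma gonality_eqI:
  assumes ub: "\<And>x. w \<le> x \<Longrightarrow> x < w + int N \<Longrightarrow> covers (pile cs) x" and g: "int (length cs) = g"
    and lb: "\<And>d. d < g \<Longrightarrow> d \<le> 9 \<and> (d = 4 \<longrightarrow> 7 \<le> N) \<and> (d = 5 \<longrightarrow> 8 \<le> N) \<and> (d = 6 \<longrightarrow> 11 \<le> N)
      \<and> (d = 7 \<longrightarrow> 12 \<le> N) \<and> (d = 8 \<longrightarrow> 15 \<le> N) \<and> (d = 9 \<longrightarrow> 16 \<le> N)"
  shows "gonality (harary4 N) = g"
  unfolding gonality_def
proof (rule Least_equality)
  show "\<exists>D\<in>divisors (harary4 N). positive_rank (harary4 N) D \<and> degree (harary4 N) D = g"
    using pile_divisor[OF ub] g by simp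
next
  fix d assume "\<exists>D\<in>divisors (harary4 N). positive_rank (harary4 N) D \<and> degree (harary4 N) D = d"
  then obtain D where D: "positive_rank (harary4 N) D" "degree (harary4 N) D = d" by blast
  show "g \<le> d"
  proof (rule ccontr)
    assume "\<not> g \<le> d"
    then have "d < g" by simp
    from lb[OF this] show False
      using positive_rank_class.degree_bound[OF effective_class[OF D]] by auto
  qed
qed

end

theorem theorem1p3:
  fixes n :: nat
  assumes "5 \<le> n"
  shows "gonality (harary4 n) =
    (if n < 16 then \<lfloor>real n / 4\<rfloor> + \<lfloor>(real n + 1) / 4\<rfloor> + 2 else 10)"
proof -
  interpret harary n using assms by unfold_locales
  have "\<lfloor>real n / 4\<rfloor> = int (n div 4)" "\<lfloor>real (n + 1) / 4\<rfloor> = int ((n + 1) div 4)"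
    using floor_divide_of_nat_eq[of n 4, where ?'a = real] floor_divide_of_nat_eq[of "n + 1" 4, where ?'a = real]
    by simp_all
  then have fl: "\<lfloor>real n / 4\<rfloor> + \<lfloor>(real n + 1) / 4\<rfloor> + 2 = int (n div 4 + (n + 1) div 4 + 2)"
    by (simp add: add.commute)
  consider "n = 5" | "n = 6" | "n = 7" | "n = 8 \<or> n = 9" | "n = 10" | "n = 11" | "n = 12 \<or> n = 13" | "n = 14" | "n = 15"
    | "16 \<le> n" using assms by atomize_elim arith
  then show ?thesis
  proof cases
    case 1
    show ?thesis unfolding fl
      by (rule gonality_eqI[of "-2" "[0, 0, 0, 0]"], rule covers_5) (use 1 in auto)
  next
    case 2
    show ?thesis unfolding fl
      by (rule gonality_eqI[of "-2" "[0, 0, 0, 0]"], rule covers_6) (use 2 in auto)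
  next
    case 3
    show ?thesis unfolding fl
      by (rule gonality_eqI[of "-2" "[0, 0, 0, 0, 3]"], rule covers_7) (use 3 in auto)
  next
    case 4
    show ?thesis unfolding fl
      by (rule gonality_eqI[of "-4" "[-2, 0, 0, 0, 0, 2]"], rule covers_spread) (use 4 in auto)
  next
    case 5
    show ?thesis unfolding fl
      by (rule gonality_eqI[of "-4" "[-2, 0, 0, 0, 0, 2]"], rule covers_10_cycle) (use 5 in auto)
  next
    case 6
    show ?thesis unfolding fl
      by (rule gonality_eqI[of "-4" "[-2, 0, 0, 0, 0, 2, 5]"], rule covers_11_cycle) (use 6 in auto)
  next
    case 7
    show ?thesis unfolding fl
      by (rule gonality_eqI[of "-6" "[-2, 0, 0, 0, 0, 2, -4, 4]"], rule covers_spread_wide) (use 7 in auto)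
  next
    case 8
    show ?thesis unfolding fl
      by (rule gonality_eqI[of "-6" "[-2, 0, 0, 0, 0, 2, -4, 4]"], rule covers_14_cycle) (use 8 in auto)
  next
    case 9
    show ?thesis unfolding fl
      by (rule gonality_eqI[of "-6" "[-2, 0, 0, 0, 0, 2, -4, 4, 7]"], rule covers_15_cycle) (use 9 in auto)
  next
    case 10
    \<comment> \<open>A single travelling stack reaches every \<open>x \<ge> 1\<close>, which
      contains a full window for every \<open>n\<close>.\<close>
    have "covers (pile [-1, 0, 0, 0, 1, 0, 1, 1, 1, 2]) x" if "1 \<le> x" for x
      using covers_10[of "nat (x - 1)"] that by simp
    then show ?thesis
      using 10 by (subst gonality_eqI[of 1 "[-1, 0, 0, 0, 1, 0, 1, 1, 1, 2]" 10]) auto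
  qed
qed

end
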